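(* Let $m,\ell\ge1$ be integers, let $X=\{x_0,x_1,\dots,x_m\}$ and $t_0\in\mathbb{R}$. Let $M>0$ be a real number, let $\mathfrak p,\mathfrak q\in[1,\infty]$ be conjugate exponents, i.e. $1/\mathfrak p+1/\mathfrak q=1$, and let $$0<T\le R<\frac{1}{M(m+1)}.$$ The maps $$\Phi\colon \ell_{\infty,M}(X^*,\mathbb{R}^\ell)\rightarrow \mathrm{BC}\big(B^m_{\mathfrak p}(R)[t_0,t_0+T],\,L^\ell_{\mathfrak q}[t_0,t_0+T]\big),\qquad c\mapsto F_c,$$ $$\Psi\colon B^m_{\mathfrak p}(R)[t_0,t_0+T]\rightarrow L\big(\ell_{\infty,M}(X^*,\mathbb{R}^\ell),\,L^\ell_{\mathfrak q}[t_0,t_0+T]\big),\qquad u\mapsto (c\mapsto F_c[u]),$$ are well defined and continuous. Therefore, the joint map $$\ell_{\infty,M}(X^*,\mathbb{R}^\ell)\times B^m_{\mathfrak p}(R)[t_0,t_0+T]\rightarrow L^\ell_{\mathfrak q}[t_0,t_0+T],\qquad (c,u)\mapsto F_c[u],$$ is also continuous.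
   Context: Words and series: $X=\{x_0,\dots,x_m\}$ is a finite set of noncommuting letters; $X^*$ is the set of all finite words over $X$, including the empty word $\emptyset$; $|\eta|$ is the length of the word $\eta$ (with $|\emptyset|=0$). A formal power series is any map $c:X^*\to\mathbb{R}^\ell$, written $c=\sum_{\eta\in X^*}(c,\eta)\,\eta$, where $(c,\eta)\in\mathbb{R}^\ell$ is the value of $c$ at $\eta$; the set of all of these is $\mathbb{R}^\ell\langle\langle X\rangle\rangle$. For $z\in\mathbb{R}^\ell$, $|z|:=\max_i|z_i|$. The Banach space $\ell_{\infty,M}(X^*,\mathbb{R}^\ell)$: for fixed $M>0$ put $\|c\|_{\ell_{\infty,M}}:=\sup\{|(c,\eta)|/(M^{|\eta|}|\eta|!):\eta\in X^*\}\in[0,\infty]$; then $\ell_{\infty,M}(X^*,\mathbb{R}^\ell)$ is the set of all $c\in\mathbb{R}^\ell\langle\langle X\rangle\rangle$ with $\|c\|_{\ell_{\infty,M}}<\infty$, normed by $\|\cdot\|_{\ell_{\infty,M}}$. Input and output spaces: for a measurable $u=(u_1,\dots,u_m):[t_0,t_1]\to\mathbb{R}^m$, $\|u\|_{\mathfrak p}:=\max_{1\le i\le m}\|u_i\|_{\mathfrak p}$, where $\|u_i\|_{\mathfrak p}$ is the usual $L_{\mathfrak p}$-norm on $[t_0,t_1]$; $L^m_{\mathfrak p}[t_0,t_1]$ is the space of measurable $u$ with $\|u\|_{\mathfrak p}<\infty$, and $B^m_{\mathfrak p}(R)[t_0,t_1]:=\{u\in L^m_{\mathfrak p}[t_0,t_1]:\|u\|_{\mathfrak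 p}\le R\}$, with the topology induced by $\|\cdot\|_{\mathfrak p}$. The space $L^\ell_{\mathfrak q}[t_0,t_1]$ is defined analogously. Iterated integrals and Chen-Fliess series: for $u\in L_1^m[t_0,t_1]$ set $u_0:=1$, $E_\emptyset[u]:=1$, and inductively for $x_i\in X$, $\bar\eta\in X^*$, $$E_{x_i\bar\eta}[u](t,t_0):=\int_{t_0}^t u_i(\tau)\,E_{\bar\eta}[u](\tau,t_0)\,d\tau .$$ The operator $F_c$ is given by the Chen-Fliess series $F_c[u](t):=\sum_{\eta\in X^*}(c,\eta)\,E_\eta[u](t,t_0)$. Function spaces: for Banach spaces $V,W$ and a subset $U\subseteq V$, $\mathrm{BC}(U,W)$ is the Banach space of bounded continuous functions $U\to W$ with the supremum norm $\|\cdot\|_\infty$, and $L(V,W)$ is the Banach space of bounded linear maps $V\to W$ with the operator norm.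
   Formalization: The formal theorem adds M(T + m R T^{1/q}) < 1 (1/q = 0 if q = ∞). Without it the claim fails: m = l = 1, M = 1/10, p = ∞, T = R = 4, u = 4, c = Σ M^n n! x_1^n gives a divergent series for t > t_0 + 5/2. The condition is sharp. *)

theory Defs
  imports "HOL-Analysis.Analysis" "HOL-Probability.Essential_Supremum" "HOL-Library.Function_Algebras"
begin

section \<open>Spaces given by a carrier and an extended seminorm\<close>

text \<open>
  The spaces involved depend on real parameters (exponents, intervals, growth constants), so
  they are carrier sets together with an extended seminorm \<open>N\<close>; subtraction of functions
  is pointwise. Elements of Lebesgue spaces are measurable functions, not equivalence classes:
  their seminorm vanishes exactly on the functions that are zero almost everywhere on the
  interval, and continuity for the induced (pseudo-metric) topology below is the same as
  continuity after passing to classes.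
\<close>

definition seminorm_topology :: "'a::minus set \<Rightarrow> ('a \<Rightarrow> ennreal) \<Rightarrow> 'a topology" where
  "seminorm_topology S N =
     topology (\<lambda>U. U \<subseteq> S \<and> (\<forall>x\<in>U. \<exists>e>0. \<forall>y\<in>S. N (y - x) < e \<longrightarrow> y \<in> U))"

lemma openin_seminorm_topology:
  "openin (seminorm_topology S N) U \<longleftrightarrow>
     U \<subseteq> S \<and> (\<forall>x\<in>U. \<exists>e>0. \<forall>y\<in>S. N (y - x) < e \<longrightarrow> y \<in> U)"
proof -
  let ?P = "\<lambda>U. U \<subseteq> S \<and> (\<forall>x\<in>U. \<exists>e>0. \<forall>y\<in>S. N (y - x) < e \<longrightarrow> y \<in> U)"
  have inter: "?P (U \<inter> V)" if U: "?P U" and V: "?P V" for U V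
  proof (intro conjI ballI)
    show "U \<inter> V \<subseteq> S" using U by blast
    fix x assume x: "x \<in> U \<inter> V"
    obtain d where d: "d > 0" "\<forall>y\<in>S. N (y - x) < d \<longrightarrow> y \<in> U" using U x by blast
    obtain e where e: "e > 0" "\<forall>y\<in>S. N (y - x) < e \<longrightarrow> y \<in> V" using V x by blast
    show "\<exists>e>0. \<forall>y\<in>S. N (y - x) < e \<longrightarrow> y \<in> U \<inter> V"
      by (rule exI[of _ "min d e"]) (use d e in auto)
  qed
  have union: "?P (\<Union>\<K>)" if "\<forall>K\<in>\<K>. ?P K" for \<K>
  proof (intro conjI ballI)
    show "\<Union>\<K> \<subseteq> S" using that by blast
    fix x assume "x \<in> \<Union>\<K>"
    then obtain K where K: "K \<in> \<K>" "x \<in> K" by blast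
    with that have "\<exists>e>0. \<forall>y\<in>S. N (y - x) < e \<longrightarrow> y \<in> K" by simp
    then show "\<exists>e>0. \<forall>y\<in>S. N (y - x) < e \<longrightarrow> y \<in> \<Union>\<K>" using K by blast
  qed
  have "istopology ?P"
    unfolding istopology_def using inter union by blast
  then show ?thesis
    by (simp add: seminorm_topology_def topology_inverse')
qed

lemma topspace_seminorm_topology [simp]: "topspace (seminorm_topology S N) = S"
proof
  show "topspace (seminorm_topology S N) \<subseteq> S"
    unfolding topspace_def openin_seminorm_topology by blast
  have "openin (seminorm_topology S N) S"
    unfolding openin_seminorm_topology using zero_less_one by blast
  then show "S \<subseteq> topspace (seminorm_topology S N)"
    by (rule openin_subset)
qed

definition sup_norm :: "'a set \<Rightarrow> ('b \<Rightarrow> ennreal) \<Rightarrow> ('a \<Rightarrow> 'b) \<Rightarrow> ennreal" where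
  "sup_norm U N f = (SUP u\<in>U. N (f u))"

text \<open>
  \<open>BC U NV W NW\<close> and \<open>bounded_lin V NV W NW\<close> are \<open>BC(U,W)\<close> and \<open>L(V,W)\<close>. Values of the maps
  outside \<open>U\<close>, respectively \<open>V\<close>, are irrelevant for membership and for the norms.
\<close>

definition BC :: "'a::minus set \<Rightarrow> ('a \<Rightarrow> ennreal) \<Rightarrow> 'b::minus set \<Rightarrow> ('b \<Rightarrow> ennreal) \<Rightarrow> ('a \<Rightarrow> 'b) set"
  where
  "BC U NV W NW =
     {f. continuous_map (seminorm_topology U NV) (seminorm_topology W NW) f \<and> sup_norm U NW f < \<infinity>}"

definition op_norm :: "'a set \<Rightarrow> ('a \<Rightarrow> ennreal) \<Rightarrow> ('b \<Rightarrow> ennreal) \<Rightarrow> ('a \<Rightarrow> 'b) \<Rightarrow> ennreal" where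
  "op_norm V NV NW A = (SUP x\<in>{x\<in>V. NV x \<le> 1}. NW (A x))"

text \<open>Linearity is an identity between elements of \<open>W\<close>, that is, up to seminorm zero.\<close>

definition bounded_lin ::
  "('i \<Rightarrow> 'v::real_vector) set \<Rightarrow> (('i \<Rightarrow> 'v) \<Rightarrow> ennreal) \<Rightarrow>
   ('j \<Rightarrow> 'w::real_vector) set \<Rightarrow> (('j \<Rightarrow> 'w) \<Rightarrow> ennreal) \<Rightarrow>
   (('i \<Rightarrow> 'v) \<Rightarrow> ('j \<Rightarrow> 'w)) set" where
  "bounded_lin V NV W NW =
     {A. A \<in> V \<rightarrow> W \<and>
         (\<forall>x\<in>V. \<forall>y\<in>V. NW (A (x + y) - (A x + A y)) = 0) \<and>
         (\<forall>a. \<forall>x\<in>V. NW (A (\<lambda>i. a *\<^sub>R x i) - (\<lambda>j. a *\<^sub>R A x j)) = 0) \<and>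
         op_norm V NV NW A < \<infinity>}"


section \<open>Lebesgue spaces of vector-valued functions\<close>

definition Lp_norm1 :: "ennreal \<Rightarrow> real \<Rightarrow> real \<Rightarrow> (real \<Rightarrow> real) \<Rightarrow> ennreal" where
  "Lp_norm1 p a b f =
     (if p = \<infinity> then esssup (lebesgue_on {a..b}) (\<lambda>t. ennreal \<bar>f t\<bar>)
      else let I = (\<integral>\<^sup>+ t. ennreal (\<bar>f t\<bar> powr enn2real p) \<partial>lebesgue_on {a..b})
           in if I = \<infinity> then \<infinity> else ennreal (enn2real I powr (1 / enn2real p)))"

definition Lp_norm :: "ennreal \<Rightarrow> real \<Rightarrow> real \<Rightarrow> (real \<Rightarrow> real^'n) \<Rightarrow> ennreal" where
  "Lp_norm p a b u = Max (range (\<lambda>i. Lp_norm1 p a b (\<lambda>t. u t $ i)))"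

definition Lp_space :: "ennreal \<Rightarrow> real \<Rightarrow> real \<Rightarrow> (real \<Rightarrow> real^'n) set" where
  "Lp_space p a b = {u \<in> borel_measurable (lebesgue_on {a..b}). Lp_norm p a b u < \<infinity>}"

definition Lp_ball :: "ennreal \<Rightarrow> real \<Rightarrow> real \<Rightarrow> real \<Rightarrow> (real \<Rightarrow> real^'n) set" where
  "Lp_ball p R a b = {u \<in> Lp_space p a b. Lp_norm p a b u \<le> ennreal R}"


section \<open>Formal power series and Chen-Fliess series\<close>

text \<open>
  With \<open>m = CARD('m)\<close>, the letter \<open>None\<close> is \<open>x\<^sub>0\<close> and the letters \<open>Some i\<close> are
  \<open>x\<^sub>1, \<dots>, x\<^sub>m\<close>.
\<close>

type_synonym 'm word = "'m option list"
type_synonym ('m, 'l) series = "'m word \<Rightarrow> real^'l"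

text \<open>The library's \<^const>\<open>infnorm\<close> is the maximum norm on \<open>real^'l\<close>.\<close>

definition linf_norm :: "real \<Rightarrow> ('m, 'l::finite) series \<Rightarrow> ennreal" where
  "linf_norm M c = (SUP \<eta>. ennreal (infnorm (c \<eta>) / (M ^ length \<eta> * fact (length \<eta>))))"

definition linf :: "real \<Rightarrow> ('m, 'l::finite) series set" where
  "linf M = {c. linf_norm M c < \<infinity>}"

fun input :: "(real \<Rightarrow> real^'m) \<Rightarrow> 'm option \<Rightarrow> real \<Rightarrow> real" where
  "input u None \<tau> = 1"
| "input u (Some i) \<tau> = u \<tau> $ i"

primrec iterated_integral :: "'m word \<Rightarrow> (real \<Rightarrow> real^'m) \<Rightarrow> real \<Rightarrow> real \<Rightarrow> real" where
  "iterated_integral [] u t t0 = 1"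
| "iterated_integral (x # \<eta>) u t t0 =
     (LINT \<tau>|lebesgue_on {t0..t}. input u x \<tau> * iterated_integral \<eta> u \<tau> t0)"

definition chen_fliess_term ::
  "('m, 'l::finite) series \<Rightarrow> (real \<Rightarrow> real^'m) \<Rightarrow> real \<Rightarrow> real \<Rightarrow> 'm word \<Rightarrow> real^'l" where
  "chen_fliess_term c u t t0 \<eta> = iterated_integral \<eta> u t t0 *\<^sub>R c \<eta>"

text \<open>
  \<^const>\<open>infsum\<close> is 0 for a family that is not (unconditionally, equivalently absolutely) summable,
  so convergence has to be asserted separately wherever it matters.
\<close>

definition chen_fliess ::
  "real \<Rightarrow> ('m, 'l::finite) series \<Rightarrow> (real \<Rightarrow> real^'m) \<Rightarrow> real \<Rightarrow> real^'l" where
  "chen_fliess t0 c u t = (\<Sum>\<^sub>\<infinity>\<eta>\<in>UNIV. chen_fliess_term c u t t0 \<eta>)"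

text \<open>
  By Hoelder, inputs in the ball satisfy \<open>\<parallel>u\<^sub>i\<parallel>\<^sub>1 \<le> R T\<^bsup>1/q\<^esup>\<close>, so the words of length \<open>n\<close> contribute at
  most a multiple of \<open>(M (T + m R T\<^bsup>1/q\<^esup>))\<^sup>n\<close>. The theorem therefore carries the hypothesis
  \<open>M (T + m R T\<^bsup>1/q\<^esup>) < 1\<close>. It follows from \<open>T \<le> R < 1/(M(m+1))\<close> in each of the cases of the
  next lemma, but not in general: for \<open>m = 1\<close>, \<open>M = 1/10\<close>, \<open>p = \<infinity>\<close>, \<open>q = 1\<close>, \<open>T = R = 4\<close>, \<open>u = 4\<close> and
  the series with coefficient \<open>M\<^sup>n n!\<close> at \<open>x\<^sub>1\<^sup>n\<close> (and 0 at all other words), the Chen-Fliess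
  series is the divergent \<open>\<Sum>n. (2(t - t\<^sub>0)/5)\<^sup>n\<close> for all \<open>t > t\<^sub>0 + 5/2\<close>. If the hypothesis fails,
  the series with all coefficients \<open>M\<^sup>n n!\<close> and the constant input \<open>R T\<^bsup>-1/p\<^esup>\<close> already
  give divergence at \<open>t = t\<^sub>0 + T\<close>.
\<close>

lemma radius_condition_automatic:
  fixes M R T :: real and p q :: ennreal and m :: nat
  assumes "M > 0" "1 \<le> p" "1 \<le> q" "1/p + 1/q = 1" "0 < T" "T \<le> R" "R < 1 / (M * (real m + 1))"
    and "T \<le> 1 \<or> p = 1 \<or> 1 \<le> M * (real m + 1)"
  shows "M * (T + real m * (R * T powr enn2real (1 / q))) < 1"
proof -
  have R1: "R * (M * (real m + 1)) < 1" using assms(1,7) by (simp add: field_simps add_pos_nonneg)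
  have le: "T powr enn2real (1/q) \<le> 1"
  proof (cases "p = 1")
    case True
    then have "1 + 1/q = 1" using assms(4) by simp
    then have "1/q = 0" using ennreal_add_left_cancel[of 1 "1/q" 0] by simp
    then show ?thesis using assms by simp
  next
    case False
    have "T \<le> 1"
    proof (rule ccontr)
      assume "\<not> T \<le> 1"
      then have "1 \<le> M * (real m + 1)" "1 < R" using assms False by auto
      then have "1 * 1 \<le> R * (M * (real m + 1))" by (intro mult_mono) auto
      then show False using R1 by simp
    qed
    then show ?thesis using assms by (simp add: powr_le1)
  qed
  have "R * T powr enn2real (1/q) \<le> R" using le assms mult_left_mono[of _ 1 R] by simp
  then have "M * (T + real m * (R * T powr enn2real (1 / q))) \<le> M * (R + real m * R)"
    using assms by (intro mult_left_mono add_mono) (auto)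
  then show ?thesis using R1 by (simp add: algebra_simps)
qed

end

theory Submission
  imports Defs
begin

text \<open>
  Write \<open>g(\<tau>) = \<Sum>\<^sub>x |u\<^sub>x(\<tau>)|\<close> for the sum over all letters, including \<open>x\<^sub>0\<close> with \<open>u\<^sub>0 = 1\<close>, and
  \<open>G(t) = \<integral>\<^bsub>t0\<^esub>\<^bsup>t\<^esup> g\<close>. Summing the recursion of the iterated integrals over the first letter gives
  \<open>\<Sum>\<^bsub>|\<eta>|=n\<^esub> |E\<^sub>\<eta>[u](t)| \<le> G(t)\<^sup>n / n!\<close> (\<open>iterated_integral_sum_le\<close>). In the same way, with
  \<open>H(t) = \<integral>\<^bsub>t0\<^esub>\<^bsup>t\<^esup> \<Sum>\<^sub>x |v\<^sub>x - u\<^sub>x|\<close>,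
  \<open>\<Sum>\<^bsub>|\<eta>|=n\<^esub> |E\<^sub>\<eta>[v](t) - E\<^sub>\<eta>[u](t)| \<le> ((G(t) + H(t))\<^sup>n - G(t)\<^sup>n) / n!\<close>
  (\<open>iterated_integral_diff_sum_le\<close>). Both inductions rest on \<open>\<integral> g G\<^sup>n = G\<^bsup>n+1\<^esup> / (n + 1)\<close>
  for merely integrable \<open>g\<close> (\<open>integral_mult_power_indefinite\<close>).

  By Hoelder, \<open>G \<le> \<rho> := T + m R T\<^bsup>1/q\<^esup>\<close> for all inputs in the ball, and \<open>M \<rho> < 1\<close>. As the
  coefficients of \<open>c\<close> grow at most like \<open>M\<^sup>n n!\<close>, the factorials cancel and the Chen-Fliess series is
  dominated by a geometric series, uniformly in \<open>t\<close> and \<open>u\<close>: up to a constant factor, the value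
  \<open>F\<^sub>c[u](t)\<close> is at most \<open>\<parallel>c\<parallel> / (1 - M \<rho>)\<close>, and \<open>F\<^sub>c[v](t) - F\<^sub>c[u](t)\<close> is at most
  \<open>\<parallel>c\<parallel> (1 / (1 - M (\<rho> + \<delta>)) - 1 / (1 - M \<rho>))\<close> whenever \<open>H \<le> \<delta>\<close> and
  \<open>M (\<rho> + \<delta>) < 1\<close>; the latter tends to 0 with \<open>\<delta>\<close>. A uniform bound on the interval bounds the
  \<open>L\<^sub>q\<close>-norm, so the first estimate and linearity in \<open>c\<close> give the continuity of \<open>c \<mapsto> F\<^sub>c\<close>, the second
  one that of \<open>u \<mapsto> (c \<mapsto> F\<^sub>c[u])\<close>, and both together that of the joint map.

  The inputs enter only through the \<open>L\<^sub>1\<close>-quantities \<open>G\<close> and \<open>H\<close>. In particular the neighbourhoods in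
  the input space needed for the joint map can be taken to be \<open>L\<^sub>1\<close>-balls, so that Minkowski's
  inequality for \<open>L\<^sub>p\<close> is not used.
\<close>

section \<open>Indefinite integrals of integrable functions\<close>

text \<open>Quadratically small increments force the derivative to vanish.\<close>

lemma constant_of_quadratic_increments:
  fixes f :: "real \<Rightarrow> real"
  assumes "convex S" and quad: "\<And>x y. x \<in> S \<Longrightarrow> y \<in> S \<Longrightarrow> \<bar>f x - f y\<bar> \<le> K * (x - y)\<^sup>2"
    and "x \<in> S" "y \<in> S"
  shows "f x = f y"
proof -
  have "(f has_field_derivative 0) (at x within S)" if x: "x \<in> S" for x
    unfolding has_field_derivative_iff
  proof (rule Lim_null_comparison)
    show "\<forall>\<^sub>F y in at x within S. norm ((f y - f x) / (y - x)) \<le> \<bar>K\<bar> * \<bar>y - x\<bar>"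
      unfolding eventually_at_filter
    proof (intro always_eventually allI impI)
      fix y assume y: "y \<noteq> x" "y \<in> S"
      have "\<bar>f y - f x\<bar> \<le> \<bar>K\<bar> * (y - x)\<^sup>2"
        using quad[OF y(2) x] by (rule order_trans) (simp add: mult_right_mono)
      then show "norm ((f y - f x) / (y - x)) \<le> \<bar>K\<bar> * \<bar>y - x\<bar>"
        using y by (simp add: divide_simps power2_eq_square mult.assoc flip: abs_mult)
    qed
    have "((\<lambda>y. \<bar>K\<bar> * \<bar>y - x\<bar>) \<longlongrightarrow> \<bar>K\<bar> * \<bar>x - x\<bar>) (at x within S)"
      by (intro tendsto_intros)
    then show "((\<lambda>y. \<bar>K\<bar> * \<bar>y - x\<bar>) \<longlongrightarrow> 0) (at x within S)" by simp
  qed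
  then show ?thesis
    using has_field_derivative_zero_constant[OF assms(1)] assms(3,4) by metis
qed

lemma continuous_indefinite_integral:
  fixes f :: "real \<Rightarrow> real"
  assumes "f absolutely_integrable_on {a..b}"
  shows "continuous_on {a..b} (\<lambda>t. integral {a..t} f)"
  using assms by (intro indefinite_integral_continuous_1) (simp add: absolutely_integrable_on_def)

lemma absolutely_integrable_mult_continuous:
  fixes f F :: "real \<Rightarrow> real"
  assumes f: "f absolutely_integrable_on {a..b}" and F: "continuous_on {a..b} F"
  shows "(\<lambda>t. f t * F t) absolutely_integrable_on {a..b}"
proof -
  have "(\<lambda>t. F t * f t) absolutely_integrable_on {a..b}"
    using F f
    by (intro absolutely_integrable_bounded_measurable_product_real
        continuous_imp_measurable_on_sets_lebesgue compact_imp_bounded compact_continuous_image) auto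
  then show ?thesis by (simp add: mult.commute)
qed

lemma integrable_on_subinterval_of_absolutely:
  fixes f :: "real \<Rightarrow> real"
  assumes "f absolutely_integrable_on {a..b}" "a \<le> s" "t \<le> b"
  shows "f integrable_on {s..t}"
  using assms absolutely_integrable_on_subinterval[where f = f and S = "{a..b}" and a = s and b = t]
  by (intro set_lebesgue_integral_eq_integral(1)) auto

lemma integral_increment:
  fixes f :: "real \<Rightarrow> real"
  assumes "f absolutely_integrable_on {a..b}" "a \<le> s" "s \<le> t" "t \<le> b"
  shows "integral {a..t} f - integral {a..s} f = integral {s..t} f"
proof -
  have "f integrable_on {a..t}"
    using assms by (auto intro: integrable_on_subinterval_of_absolutely)
  from Henstock_Kurzweil_Integration.integral_combine[OF assms(2,3) this] show ?thesis by simp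
qed

text \<open>
  Integration by parts for indefinite integrals \<open>F\<close>, \<open>G\<close> of integrable functions, which need not be
  differentiable at any given point. The defect \<open>D\<close> of the identity has increments bounded by
  \<open>2 (J(t) - J(s))\<^sup>2\<close>, where \<open>J\<close> is the indefinite integral of \<open>1 + |f| + |g|\<close>. This \<open>J\<close> is strictly
  increasing and continuous, so that \<open>D\<close>, reparametrized by \<open>J\<close>, is constant.
\<close>

lemma integration_by_parts_absolutely_integrable:
  fixes f g :: "real \<Rightarrow> real"
  assumes f: "f absolutely_integrable_on {a..b}" and g: "g absolutely_integrable_on {a..b}"
    and t: "t \<in> {a..b}"
  shows "integral {a..t} (\<lambda>\<tau>. f \<tau> * integral {a..\<tau>} g + g \<tau> * integral {a..\<tau>} f)
       = integral {a..t} f * integral {a..t} g"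
proof -
  define F G where "F t = integral {a..t} f" and "G t = integral {a..t} g" for t
  define k where "k \<tau> = f \<tau> * G \<tau> + g \<tau> * F \<tau>" for \<tau>
  define j where "j \<tau> = 1 + \<bar>f \<tau>\<bar> + \<bar>g \<tau>\<bar>" for \<tau>
  define J where "J t = integral {a..t} j" for t
  define D where "D t = F t * G t - integral {a..t} k" for t
  have abs: "\<bar>f \<tau>\<bar> \<le> j \<tau>" "\<bar>g \<tau>\<bar> \<le> j \<tau>" "1 \<le> j \<tau>" for \<tau> by (auto simp: j_def)
  have F: "continuous_on {a..b} F" and G: "continuous_on {a..b} G"
    unfolding F_def G_def using f g by (auto intro: continuous_indefinite_integral)
  have k: "k absolutely_integrable_on {a..b}"
    unfolding k_def using f g F G
    by (intro set_integral_add(1) absolutely_integrable_mult_continuous) auto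
  have j: "j absolutely_integrable_on {a..b}"
    unfolding j_def using f g
    by (intro set_integral_add(1) set_integrable_abs) auto
  have le: "\<bar>integral {s..t} h\<bar> \<le> J t - J s"
    if "h absolutely_integrable_on {a..b}" "\<And>\<tau>. \<bar>h \<tau>\<bar> \<le> j \<tau>" "a \<le> s" "s \<le> t" "t \<le> b" for h s t
  proof -
    have "norm (integral {s..t} h) \<le> integral {s..t} j"
      using that(2) integrable_on_subinterval_of_absolutely[OF that(1,3,5)]
        integrable_on_subinterval_of_absolutely[OF j that(3,5)]
      by (intro integral_norm_bound_integral) auto
    then show ?thesis using integral_increment[OF j that(3-5)] by (simp add: J_def)
  qed
  have J_mono: "t - s \<le> J t - J s" if "a \<le> s" "s \<le> t" "t \<le> b" for s t
    using le[of "\<lambda>_. 1" s t] that abs(3) by simp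
  have quad: "\<bar>D t - D s\<bar> \<le> 2 * (J t - J s)\<^sup>2" if st: "a \<le> s" "s \<le> t" "t \<le> b" for s t
  proof -
    have int: "f integrable_on {s..t}" "g integrable_on {s..t}"
      "k integrable_on {s..t}" "j integrable_on {s..t}"
      using st f g k j by (auto intro: integrable_on_subinterval_of_absolutely)
    have inc: "F y - F x = integral {x..y} f" "G y - G x = integral {x..y} g"
      if "a \<le> x" "x \<le> y" "y \<le> b" for x y
      unfolding F_def G_def using f g that by (auto intro: integral_increment)
    have "D t - D s = (F t - F s) * G t + F s * (G t - G s) - integral {s..t} k"
      using integral_increment[OF k st] by (simp add: D_def algebra_simps)
    also have "\<dots> = integral {s..t} f * G t + F s * integral {s..t} g - integral {s..t} k"
      using st inc by simp
    also have "\<dots> = integral {s..t} (\<lambda>\<tau>. f \<tau> * G t + F s * g \<tau> - k \<tau>)"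
      by (rule integral_unique[symmetric])
         (intro has_integral_diff has_integral_add has_integral_mult_left has_integral_mult_right
            integrable_integral int)
    also have "norm \<dots> \<le> integral {s..t} (\<lambda>\<tau>. 2 * (J t - J s) * j \<tau>)"
      \<comment> \<open>The integrand vanishes when \<open>F\<close> and \<open>G\<close> are constant on \<open>[s, t]\<close>; it is
          \<open>f(\<tau>) (G(t) - G(\<tau>)) + g(\<tau>) (F(s) - F(\<tau>))\<close>.\<close>
    proof (rule integral_norm_bound_integral)
      show "(\<lambda>\<tau>. f \<tau> * G t + F s * g \<tau> - k \<tau>) integrable_on {s..t}"
        using int by (intro integrable_diff integrable_add
            integrable_on_mult_left integrable_on_mult_right) auto
      show "(\<lambda>\<tau>. 2 * (J t - J s) * j \<tau>) integrable_on {s..t}"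
        by (intro integrable_on_mult_right int)
      fix \<tau> assume \<tau>: "\<tau> \<in> {s..t}"
      have "\<bar>G t - G \<tau>\<bar> \<le> J t - J \<tau>" "\<bar>F \<tau> - F s\<bar> \<le> J \<tau> - J s"
        using \<tau> st inc le[OF g abs(2), of \<tau> t] le[OF f abs(1), of s \<tau>] by auto
      moreover have "J s \<le> J \<tau>" "J \<tau> \<le> J t"
        using J_mono[of s \<tau>] J_mono[of \<tau> t] \<tau> st by auto
      ultimately have *: "\<bar>G t - G \<tau>\<bar> \<le> J t - J s" "\<bar>F s - F \<tau>\<bar> \<le> J t - J s" by linarith+
      have "f \<tau> * G t + F s * g \<tau> - k \<tau> = f \<tau> * (G t - G \<tau>) + g \<tau> * (F s - F \<tau>)"
        by (simp add: k_def algebra_simps)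
      also have "\<bar>\<dots>\<bar> \<le> \<bar>f \<tau>\<bar> * \<bar>G t - G \<tau>\<bar> + \<bar>g \<tau>\<bar> * \<bar>F s - F \<tau>\<bar>"
        by (metis abs_mult abs_triangle_ineq)
      also have "\<dots> \<le> j \<tau> * (J t - J s) + j \<tau> * (J t - J s)"
        using * abs by (intro add_mono mult_mono) (auto simp: j_def)
      finally show "norm (f \<tau> * G t + F s * g \<tau> - k \<tau>) \<le> 2 * (J t - J s) * j \<tau>"
        by (simp add: algebra_simps)
    qed
    also have "\<dots> = 2 * (J t - J s) * integral {s..t} j" by simp
    also have "integral {s..t} j = J t - J s"
      unfolding J_def using integral_increment[OF j st] by simp
    finally show ?thesis by (simp only: power2_eq_square mult.assoc real_norm_def)
  qed
  have quad': "\<bar>D t - D s\<bar> \<le> 2 * (J t - J s)\<^sup>2" if "s \<in> {a..b}" "t \<in> {a..b}" for s t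
    using quad[of s t] quad[of t s] that
    by (cases "s \<le> t") (auto simp: abs_minus_commute power2_commute)
  have inj: "inj_on J {a..b}"
  proof (rule linorder_inj_onI)
    show "J x \<noteq> J y" if "x < y" "x \<in> {a..b}" "y \<in> {a..b}" for x y
      using J_mono[of x y] that by auto
  qed auto
  define h where "h = the_inv_into {a..b} J"
  have hJ: "h (J s) = s" if "s \<in> {a..b}" for s
    unfolding h_def using the_inv_into_f_f[OF inj that] .
  have "connected (J ` {a..b})"
    unfolding J_def by (intro connected_continuous_image continuous_indefinite_integral j) auto
  then have "convex (J ` {a..b})" by (simp add: connected_convex_1)
  then have "(D \<circ> h) (J t) = (D \<circ> h) (J a)"
    by (rule constant_of_quadratic_increments[where K = 2]) (use quad' hJ t in auto)
  then have "D t = D a" using hJ t by simp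
  also have "D a = 0" by (simp add: D_def F_def)
  finally show ?thesis by (simp add: D_def k_def[abs_def] F_def G_def)
qed

text \<open>By induction on \<open>n\<close>: integrate \<open>g G\<^bsup>n+1\<^esup>\<close> by parts, with \<open>G\<^bsup>n+1\<^esup> / (n + 1)\<close> as the
  indefinite integral of \<open>g G\<^sup>n\<close>.\<close>

lemma integral_mult_power_indefinite:
  fixes g :: "real \<Rightarrow> real"
  assumes g: "g absolutely_integrable_on {a..b}" and t: "t \<in> {a..b}"
  shows "integral {a..t} (\<lambda>\<tau>. g \<tau> * integral {a..\<tau>} g ^ n) = integral {a..t} g ^ Suc n / Suc n"
  using t
proof (induction n arbitrary: t)
  case 0
  then show ?case by simp
next
  case (Suc n)
  define G where "G t = integral {a..t} g" for t
  have G: "continuous_on {a..b} G"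
    unfolding G_def by (rule continuous_indefinite_integral[OF g])
  have int: "(\<lambda>\<tau>. g \<tau> * G \<tau> ^ m) absolutely_integrable_on {a..b}" for m
    by (intro absolutely_integrable_mult_continuous g continuous_intros G)
  have sub: "(\<lambda>\<tau>. g \<tau> * G \<tau> ^ m) integrable_on {a..t}" for m
    using integrable_on_subinterval_of_absolutely[OF int] Suc.prems by simp
  define I where "I m = integral {a..t} (\<lambda>\<tau>. g \<tau> * G \<tau> ^ m)" for m
  have "G t ^ Suc n / Suc n * G t = I n * G t"
    using Suc.IH[OF Suc.prems] by (simp add: I_def G_def)
  also have "\<dots> = integral {a..t} (\<lambda>\<tau>. g \<tau> * G \<tau> ^ n * G \<tau> + g \<tau> * integral {a..\<tau>} (\<lambda>\<tau>. g \<tau> * G \<tau> ^ n))"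
    using integration_by_parts_absolutely_integrable[OF int g Suc.prems, of n]
    by (simp add: G_def I_def)
  also have "\<dots> = integral {a..t} (\<lambda>\<tau>. (1 + 1 / Suc n) * (g \<tau> * G \<tau> ^ Suc n))"
    using Suc.prems Suc.IH
    by (intro Henstock_Kurzweil_Integration.integral_cong) (auto simp: G_def field_simps)
  also have "\<dots> = (1 + 1 / Suc n) * I (Suc n)" by (simp only: integral_mult_right I_def)
  finally have "G t ^ Suc (Suc n) / Suc n = (1 + 1 / Suc n) * I (Suc n)" by (simp add: mult_ac)
  then show ?case by (simp add: I_def G_def field_simps)
qed

section \<open>Iterated integrals\<close>

lemma
  fixes u :: "real \<Rightarrow> real^'m"
  assumes u: "\<And>x. input u x absolutely_integrable_on {a..b}"
  shows continuous_iterated_integral: "continuous_on {a..b} (\<lambda>t. iterated_integral \<eta> u t a)"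
    and iterated_integral_Cons_eq: "t \<in> {a..b} \<Longrightarrow>
      iterated_integral (x # \<eta>) u t a = integral {a..t} (\<lambda>\<tau>. input u x \<tau> * iterated_integral \<eta> u \<tau> a)"
proof -
  have Cons_eq: "iterated_integral (x # \<eta>) u t a = integral {a..t} (\<lambda>\<tau>. input u x \<tau> * iterated_integral \<eta> u \<tau> a)"
    if "continuous_on {a..b} (\<lambda>t. iterated_integral \<eta> u t a)" "t \<in> {a..b}" for \<eta> x t
  proof -
    have "(\<lambda>\<tau>. input u x \<tau> * iterated_integral \<eta> u \<tau> a) absolutely_integrable_on {a..b}"
      using u that by (intro absolutely_integrable_mult_continuous) auto
    then have "(\<lambda>\<tau>. input u x \<tau> * iterated_integral \<eta> u \<tau> a) absolutely_integrable_on {a..t}"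
      using that by (rule_tac absolutely_integrable_on_subinterval) auto
    then show ?thesis
      by (simp add: lebesgue_integral_eq_integral absolutely_integrable_imp_integrable)
  qed
  show cont: "continuous_on {a..b} (\<lambda>t. iterated_integral \<eta> u t a)" for \<eta>
  proof (induction \<eta>)
    case (Cons x \<eta>)
    have "continuous_on {a..b} (\<lambda>t. integral {a..t} (\<lambda>\<tau>. input u x \<tau> * iterated_integral \<eta> u \<tau> a))"
      by (intro continuous_indefinite_integral absolutely_integrable_mult_continuous u Cons)
    then show ?case
      by (rule continuous_on_eq) (simp only: Cons_eq[OF Cons])
  qed simp
  show "iterated_integral (x # \<eta>) u t a = integral {a..t} (\<lambda>\<tau>. input u x \<tau> * iterated_integral \<eta> u \<tau> a)"
    if "t \<in> {a..b}" using Cons_eq cont that by blast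
qed

lemma finite_words_of_length: "finite {\<eta> :: 'x::finite list. length \<eta> = n}"
  using finite_lists_length_eq[of "UNIV :: 'x set" n] by simp

lemma sum_words_Suc:
  fixes f :: "'x::finite list \<Rightarrow> 'a::comm_monoid_add"
  shows "(\<Sum>\<eta> | length \<eta> = Suc n. f \<eta>) = (\<Sum>x\<in>UNIV. \<Sum>\<eta> | length \<eta> = n. f (x # \<eta>))"
proof -
  have "(\<Sum>\<eta> | length \<eta> = Suc n. f \<eta>) = (\<Sum>(x, \<eta>)\<in>UNIV \<times> {\<eta>. length \<eta> = n}. f (x # \<eta>))"
    by (rule sum.reindex_bij_witness[of _ "\<lambda>(x, \<eta>). x # \<eta>" "\<lambda>\<eta>. (hd \<eta>, tl \<eta>)"])
       (auto simp: length_Suc_conv)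
  then show ?thesis by (simp add: sum.cartesian_product)
qed

text \<open>
  The iterated integrals over all words of length \<open>n\<close> are bounded together, and not word by word: the
  sum over the first letter reproduces the integrand \<open>g\<close> of \<open>G\<close>.
\<close>

lemma iterated_integral_sum_le:
  fixes u :: "real \<Rightarrow> real^'m::finite"
  assumes u: "\<And>x. input u x absolutely_integrable_on {a..b}" and t: "t \<in> {a..b}"
  shows "(\<Sum>\<eta> | length \<eta> = n. \<bar>iterated_integral \<eta> u t a\<bar>)
    \<le> integral {a..t} (\<lambda>\<tau>. \<Sum>x\<in>UNIV. \<bar>input u x \<tau>\<bar>) ^ n / fact n"
  using t
proof (induction n arbitrary: t)
  case (Suc n)
  define g where "g \<tau> = (\<Sum>x\<in>UNIV. \<bar>input u x \<tau>\<bar>)" for \<tau>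
  define G where "G t = integral {a..t} g" for t
  define E where "E \<eta> \<tau> = iterated_integral \<eta> u \<tau> a" for \<eta> \<tau>
  note cont = continuous_iterated_integral[where u = u and a = a and b = b, OF u, folded E_def]
  have g: "g absolutely_integrable_on {a..b}"
    unfolding g_def by (intro absolutely_integrable_sum set_integrable_abs u) auto
  have G: "continuous_on {a..b} G"
    unfolding G_def by (rule continuous_indefinite_integral[OF g])
  have int: "(\<lambda>\<tau>. \<bar>input u x \<tau>\<bar> * \<bar>E \<eta> \<tau>\<bar>) integrable_on {a..t}"
    "(\<lambda>\<tau>. input u x \<tau> * E \<eta> \<tau>) integrable_on {a..t}" for x \<eta>
    using Suc.prems
    by (auto intro!: integrable_on_subinterval_of_absolutely[where a = a and b = b] cont u set_integrable_abs
        absolutely_integrable_mult_continuous continuous_on_rabs)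
  have "(\<Sum>\<eta> | length \<eta> = Suc n. \<bar>E \<eta> t\<bar>)
      = (\<Sum>x\<in>UNIV. \<Sum>\<eta> | length \<eta> = n. \<bar>integral {a..t} (\<lambda>\<tau>. input u x \<tau> * E \<eta> \<tau>)\<bar>)"
    unfolding E_def sum_words_Suc by (subst iterated_integral_Cons_eq[OF u Suc.prems]) (rule refl)
  also have "\<dots> \<le> (\<Sum>x\<in>UNIV. \<Sum>\<eta> | length \<eta> = n. integral {a..t} (\<lambda>\<tau>. \<bar>input u x \<tau>\<bar> * \<bar>E \<eta> \<tau>\<bar>))"
    using int
    by (intro sum_mono integral_norm_bound_integral[where 'a = real, simplified]) (auto simp: abs_mult)
  also have "\<dots> = integral {a..t} (\<lambda>\<tau>. \<Sum>x\<in>UNIV. \<Sum>\<eta> | length \<eta> = n. \<bar>input u x \<tau>\<bar> * \<bar>E \<eta> \<tau>\<bar>)"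
    using int by (simp add: Henstock_Kurzweil_Integration.integral_sum integrable_sum finite_words_of_length)
  also have "\<dots> = integral {a..t} (\<lambda>\<tau>. g \<tau> * (\<Sum>\<eta> | length \<eta> = n. \<bar>E \<eta> \<tau>\<bar>))"
    by (simp add: g_def sum_product)
  also have "\<dots> \<le> integral {a..t} (\<lambda>\<tau>. g \<tau> * (G \<tau> ^ n / fact n))"
  proof (rule integral_le)
    show "(\<lambda>\<tau>. g \<tau> * (\<Sum>\<eta> | length \<eta> = n. \<bar>E \<eta> \<tau>\<bar>)) integrable_on {a..t}"
      "(\<lambda>\<tau>. g \<tau> * (G \<tau> ^ n / fact n)) integrable_on {a..t}"
      using Suc.prems
      by (auto intro!: integrable_on_subinterval_of_absolutely[where a = a and b = b] cont g G
        absolutely_integrable_mult_continuous continuous_intros)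
    show "g \<tau> * (\<Sum>\<eta> | length \<eta> = n. \<bar>E \<eta> \<tau>\<bar>) \<le> g \<tau> * (G \<tau> ^ n / fact n)" if "\<tau> \<in> {a..t}" for \<tau>
      using Suc.IH[of \<tau>] Suc.prems that
      by (intro mult_left_mono) (auto simp: E_def G_def g_def[abs_def] intro!: sum_nonneg)
  qed
  also have "\<dots> = integral {a..t} (\<lambda>\<tau>. g \<tau> * G \<tau> ^ n) / fact n"
    by (simp flip: integral_divide)
  also have "\<dots> = G t ^ Suc n / fact (Suc n)"
    unfolding G_def integral_mult_power_indefinite[OF g Suc.prems]
    by (simp del: power_Suc of_nat_Suc)
  finally show ?case by (simp only: E_def G_def g_def[abs_def])
qed simp

text \<open>
  The analogous bound for the difference of two inputs. The right-hand side is exactly what the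
  recursion reproduces: with \<open>k = g + h\<close> and \<open>K = G + H\<close>, the induction step integrates
  \<open>k (K\<^sup>n - G\<^sup>n) + h G\<^sup>n = k K\<^sup>n - g G\<^sup>n\<close>.
\<close>

lemma iterated_integral_diff_sum_le:
  fixes u v :: "real \<Rightarrow> real^'m::finite"
  assumes u: "\<And>x. input u x absolutely_integrable_on {a..b}"
    and v: "\<And>x. input v x absolutely_integrable_on {a..b}" and t: "t \<in> {a..b}"
  shows "(\<Sum>\<eta> | length \<eta> = n. \<bar>iterated_integral \<eta> v t a - iterated_integral \<eta> u t a\<bar>)
    \<le> ((integral {a..t} (\<lambda>\<tau>. \<Sum>x\<in>UNIV. \<bar>input u x \<tau>\<bar>)
         + integral {a..t} (\<lambda>\<tau>. \<Sum>x\<in>UNIV. \<bar>input v x \<tau> - input u x \<tau>\<bar>)) ^ n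
       - integral {a..t} (\<lambda>\<tau>. \<Sum>x\<in>UNIV. \<bar>input u x \<tau>\<bar>) ^ n) / fact n"
  using t
proof (induction n arbitrary: t)
  case (Suc n)
  define g where "g \<tau> = (\<Sum>x\<in>UNIV. \<bar>input u x \<tau>\<bar>)" for \<tau>
  define h where "h \<tau> = (\<Sum>x\<in>UNIV. \<bar>input v x \<tau> - input u x \<tau>\<bar>)" for \<tau>
  define k where "k \<tau> = g \<tau> + h \<tau>" for \<tau>
  define G where "G t = integral {a..t} g" for t
  define K where "K t = integral {a..t} k" for t
  define S where "S \<tau> = (\<Sum>\<eta> | length \<eta> = n. \<bar>iterated_integral \<eta> u \<tau> a\<bar>)" for \<tau>
  define D where "D \<tau> = (\<Sum>\<eta> | length \<eta> = n. \<bar>iterated_integral \<eta> v \<tau> a - iterated_integral \<eta> u \<tau> a\<bar>)" for \<tau>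
  define e where "e x \<eta> \<tau> = (\<bar>input u x \<tau>\<bar> + \<bar>input v x \<tau> - input u x \<tau>\<bar>)
      * \<bar>iterated_integral \<eta> v \<tau> a - iterated_integral \<eta> u \<tau> a\<bar>
      + \<bar>input v x \<tau> - input u x \<tau>\<bar> * \<bar>iterated_integral \<eta> u \<tau> a\<bar>" for x \<eta> \<tau>
  note cont = continuous_iterated_integral[where u = u and a = a and b = b, OF u]
    continuous_iterated_integral[where u = v and a = a and b = b, OF v]
  have gh: "g absolutely_integrable_on {a..b}" "h absolutely_integrable_on {a..b}"
    unfolding g_def h_def
    by (intro absolutely_integrable_sum set_integrable_abs set_integral_diff(1) u v; simp)+
  then have k: "k absolutely_integrable_on {a..b}"
    unfolding k_def by (rule set_integral_add(1))
  have K_eq: "K t = G t + integral {a..t} h" if "t \<in> {a..b}" for t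
    using gh that unfolding K_def G_def k_def
    by (intro Henstock_Kurzweil_Integration.integral_add
        integrable_on_subinterval_of_absolutely[where a = a and b = b]) auto
  have IH: "D t \<le> (K t ^ n - G t ^ n) / fact n" if "t \<in> {a..b}" for t
    using Suc.IH[OF that] K_eq[OF that] by (simp add: D_def G_def g_def[abs_def] h_def[abs_def])
  have S_le: "S t \<le> G t ^ n / fact n" if "t \<in> {a..b}" for t
    using iterated_integral_sum_le[OF u that, of n] by (simp add: S_def G_def g_def[abs_def])
  have cont_GK: "continuous_on {a..b} G" "continuous_on {a..b} K"
    unfolding G_def K_def using gh k by (auto intro: continuous_indefinite_integral)
  have cont_SD: "continuous_on {a..b} S" "continuous_on {a..b} D"
    unfolding S_def D_def by (intro continuous_intros cont)+
  have int_uv: "(\<lambda>\<tau>. input u x \<tau> * iterated_integral \<eta> u \<tau> a) integrable_on {a..t}"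
    "(\<lambda>\<tau>. input v x \<tau> * iterated_integral \<eta> v \<tau> a) integrable_on {a..t}" for x \<eta>
    using Suc.prems
    by (auto intro!: integrable_on_subinterval_of_absolutely[where a = a and b = b] cont u v
        absolutely_integrable_mult_continuous)
  have int_e: "e x \<eta> integrable_on {a..t}" for x \<eta>
    unfolding e_def
    by (rule integrable_on_subinterval_of_absolutely[where a = a and b = b],
        intro set_integral_add(1) absolutely_integrable_mult_continuous set_integrable_abs
        set_integral_diff(1) u v continuous_intros cont) (use Suc.prems in auto)
  have abs_le: "\<bar>integral {a..t} (\<lambda>\<tau>. input v x \<tau> * iterated_integral \<eta> v \<tau> a)
            - integral {a..t} (\<lambda>\<tau>. input u x \<tau> * iterated_integral \<eta> u \<tau> a)\<bar>
          \<le> integral {a..t} (e x \<eta>)" for x \<eta>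
  proof -
    have "norm (integral {a..t} (\<lambda>\<tau>. input v x \<tau> * iterated_integral \<eta> v \<tau> a
        - input u x \<tau> * iterated_integral \<eta> u \<tau> a))
      \<le> integral {a..t} (e x \<eta>)"
    proof (rule integral_norm_bound_integral)
      fix \<tau>
      let ?p = "input u x \<tau>" and ?q = "input v x \<tau>"
      let ?P = "iterated_integral \<eta> u \<tau> a" and ?Q = "iterated_integral \<eta> v \<tau> a"
      have "\<bar>?q * ?Q - ?p * ?P\<bar> = \<bar>?q * (?Q - ?P) + (?q - ?p) * ?P\<bar>" by (simp add: algebra_simps)
      also have "\<dots> \<le> \<bar>?q\<bar> * \<bar>?Q - ?P\<bar> + \<bar>?q - ?p\<bar> * \<bar>?P\<bar>" by (metis abs_mult abs_triangle_ineq)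
      also have "\<dots> \<le> e x \<eta> \<tau>" unfolding e_def by (intro add_mono mult_right_mono) auto
      finally show "norm (?q * ?Q - ?p * ?P) \<le> e x \<eta> \<tau>" by simp
    qed (use int_uv int_e in \<open>auto intro: integrable_diff\<close>)
    then show ?thesis using int_uv by (simp add: Henstock_Kurzweil_Integration.integral_diff)
  qed
  have "(\<Sum>\<eta> | length \<eta> = Suc n. \<bar>iterated_integral \<eta> v t a - iterated_integral \<eta> u t a\<bar>)
      = (\<Sum>x\<in>UNIV. \<Sum>\<eta> | length \<eta> = n. \<bar>integral {a..t} (\<lambda>\<tau>. input v x \<tau> * iterated_integral \<eta> v \<tau> a)
            - integral {a..t} (\<lambda>\<tau>. input u x \<tau> * iterated_integral \<eta> u \<tau> a)\<bar>)"
    unfolding sum_words_Suc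
    by (subst iterated_integral_Cons_eq[OF u Suc.prems],
        subst iterated_integral_Cons_eq[OF v Suc.prems]) (rule refl)
  also have "\<dots> \<le> (\<Sum>x\<in>UNIV. \<Sum>\<eta> | length \<eta> = n. integral {a..t} (e x \<eta>))"
    by (intro sum_mono abs_le)
  also have "\<dots> = integral {a..t} (\<lambda>\<tau>. \<Sum>x\<in>UNIV. \<Sum>\<eta> | length \<eta> = n. e x \<eta> \<tau>)"
    using int_e by (simp add: Henstock_Kurzweil_Integration.integral_sum integrable_sum finite_words_of_length)
  also have "\<dots> = integral {a..t} (\<lambda>\<tau>. k \<tau> * D \<tau> + h \<tau> * S \<tau>)"
    by (simp add: k_def g_def h_def e_def D_def S_def sum_product sum.distrib flip: sum.distrib)
  also have "\<dots> \<le> integral {a..t} (\<lambda>\<tau>. (k \<tau> * K \<tau> ^ n - g \<tau> * G \<tau> ^ n) / fact n)"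
  proof (rule integral_le)
    show "(\<lambda>\<tau>. k \<tau> * D \<tau> + h \<tau> * S \<tau>) integrable_on {a..t}"
      "(\<lambda>\<tau>. (k \<tau> * K \<tau> ^ n - g \<tau> * G \<tau> ^ n) / fact n) integrable_on {a..t}"
      using Suc.prems
      by (auto intro!: integrable_on_subinterval_of_absolutely[where a = a and b = b] gh k cont_GK cont_SD
        absolutely_integrable_mult_continuous continuous_intros set_integral_add(1) set_integral_diff(1)
        set_integrable_divide)
    show "k \<tau> * D \<tau> + h \<tau> * S \<tau> \<le> (k \<tau> * K \<tau> ^ n - g \<tau> * G \<tau> ^ n) / fact n" if "\<tau> \<in> {a..t}" for \<tau>
    proof -
      have "h \<tau> \<ge> 0" "g \<tau> \<ge> 0" by (auto simp: h_def g_def intro!: sum_nonneg)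
      then have "k \<tau> * D \<tau> + h \<tau> * S \<tau> \<le> k \<tau> * ((K \<tau> ^ n - G \<tau> ^ n) / fact n) + h \<tau> * (G \<tau> ^ n / fact n)"
        using IH[of \<tau>] S_le[of \<tau>] that Suc.prems by (intro add_mono mult_left_mono) (auto simp: k_def)
      also have "\<dots> = (k \<tau> * K \<tau> ^ n - g \<tau> * G \<tau> ^ n) / fact n"
        by (simp add: k_def field_simps)
      finally show ?thesis .
    qed
  qed
  also have "\<dots> = (integral {a..t} (\<lambda>\<tau>. k \<tau> * K \<tau> ^ n) - integral {a..t} (\<lambda>\<tau>. g \<tau> * G \<tau> ^ n)) / fact n"
  proof -
    have "(\<lambda>\<tau>. k \<tau> * K \<tau> ^ n) integrable_on {a..t}" "(\<lambda>\<tau>. g \<tau> * G \<tau> ^ n) integrable_on {a..t}"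
      using Suc.prems
      by (auto intro!: integrable_on_subinterval_of_absolutely[where a = a and b = b] gh k cont_GK
        absolutely_integrable_mult_continuous continuous_intros)
    then show ?thesis by (simp add: Henstock_Kurzweil_Integration.integral_diff)
  qed
  also have "\<dots> = (K t ^ Suc n - G t ^ Suc n) / fact (Suc n)"
    unfolding G_def K_def integral_mult_power_indefinite[OF gh(1) Suc.prems]
      integral_mult_power_indefinite[OF k Suc.prems]
    by (simp add: diff_divide_distrib del: power_Suc of_nat_Suc)
  finally show ?case using K_eq[OF Suc.prems] by (simp only: G_def g_def[abs_def] h_def[abs_def])
qed simp

section \<open>Convergence and continuity estimates for Chen-Fliess series\<close>

text \<open>
  As the alphabet is finite, an unconditional sum over all words is the limit of the sums over the
  words of length at most \<open>n\<close>.
\<close>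

lemma filterlim_words_length_le:
  "filterlim (\<lambda>n. {\<eta> :: 'x::finite list. length \<eta> \<le> n}) (finite_subsets_at_top UNIV) sequentially"
  unfolding filterlim_finite_subsets_at_top
proof (intro allI impI)
  fix X :: "'x list set" assume X: "finite X \<and> X \<subseteq> UNIV"
  then have "X \<subseteq> {\<eta>. length \<eta> \<le> n}" if "n \<ge> Max (insert 0 (length ` X))" for n
    using that by auto
  then show "\<forall>\<^sub>F n in sequentially. finite {\<eta> :: 'x list. length \<eta> \<le> n}
      \<and> X \<subseteq> {\<eta>. length \<eta> \<le> n} \<and> {\<eta>. length \<eta> \<le> n} \<subseteq> UNIV"
    using finite_lists_length_le[of "UNIV :: 'x set"] by (auto simp: eventually_sequentially)
qed

lemma
  fixes f :: "'x::finite list \<Rightarrow> 'b::banach"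
  assumes le: "\<And>n. (\<Sum>\<eta> | length \<eta> = n. norm (f \<eta>)) \<le> B n" and B: "B sums S"
  shows summable_on_words: "f summable_on UNIV"
    and norm_infsum_words_le: "norm (infsum f UNIV) \<le> S"
proof -
  have B0: "B n \<ge> 0" for n
    using le[of n] by (rule order_trans[rotated]) (simp add: sum_nonneg)
  have fin: "(\<Sum>\<eta>\<in>F. norm (f \<eta>)) \<le> S" if "finite F" for F
  proof -
    define N where "N = Suc (Max (insert 0 (length ` F)))"
    have "(\<Sum>\<eta>\<in>F. norm (f \<eta>)) \<le> (\<Sum>\<eta>\<in>(\<Union>n<N. {\<eta>. length \<eta> = n}). norm (f \<eta>))"
      using that by (intro sum_mono2) (auto simp: finite_words_of_length N_def less_Suc_eq_le)
    also have "\<dots> = (\<Sum>n<N. \<Sum>\<eta> | length \<eta> = n. norm (f \<eta>))"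
      by (rule sum.UNION_disjoint) (auto simp: finite_words_of_length)
    also have "\<dots> \<le> (\<Sum>n<N. B n)" by (intro sum_mono le)
    also have "\<dots> \<le> S" using sum_le_suminf[of B "{..<N}"] B B0 by (auto simp: sums_iff)
    finally show ?thesis .
  qed
  then have abs: "f abs_summable_on UNIV"
    by (intro nonneg_bdd_above_summable_on) (auto intro!: bdd_aboveI[where M = S])
  then show "f summable_on UNIV" by (rule abs_summable_summable)
  show "norm (infsum f UNIV) \<le> S"
    using norm_infsum_bound[OF abs] infsum_le_finite_sums[OF abs, of S] fin by (rule_tac order_trans) auto
qed

text \<open>The integral over \<open>[a, t]\<close> of the sum over all letters, including \<open>x\<^sub>0\<close>, of \<open>|u\<^sub>x|\<close>.\<close>

definition input_mass :: "(real \<Rightarrow> real^'m::finite) \<Rightarrow> real \<Rightarrow> real \<Rightarrow> real" where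
  "input_mass u a t = integral {a..t} (\<lambda>\<tau>. \<Sum>x\<in>UNIV. \<bar>input u x \<tau>\<bar>)"

text \<open>
  The \<open>L\<^sub>1\<close>-distance of two inputs on \<open>[a, t]\<close>, with the components added up; the letter \<open>x\<^sub>0\<close>
  contributes 0.
\<close>

definition input_dist :: "(real \<Rightarrow> real^'m::finite) \<Rightarrow> (real \<Rightarrow> real^'m) \<Rightarrow> real \<Rightarrow> real \<Rightarrow> real" where
  "input_dist u v a t = integral {a..t} (\<lambda>\<tau>. \<Sum>x\<in>UNIV. \<bar>input v x \<tau> - input u x \<tau>\<bar>)"

text \<open>All components of the input are Lebesgue integrable on \<open>[a, b]\<close>.\<close>

definition integrable_input :: "real \<Rightarrow> real \<Rightarrow> (real \<Rightarrow> real^'m) \<Rightarrow> bool" where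
  "integrable_input a b u \<longleftrightarrow> (\<forall>x. input u x absolutely_integrable_on {a..b})"

lemma integral_mono_interval:
  fixes f :: "real \<Rightarrow> real"
  assumes "f absolutely_integrable_on {a..b}" "\<And>\<tau>. f \<tau> \<ge> 0" "t \<in> {a..b}"
  shows "0 \<le> integral {a..t} f" "integral {a..t} f \<le> integral {a..b} f"
  using assms
  by (auto intro!: Henstock_Kurzweil_Integration.integral_nonneg integral_subset_le
      integrable_on_subinterval_of_absolutely[where a = a and b = b])

lemma
  assumes "integrable_input a b u" "t \<in> {a..b}"
  shows input_mass_nonneg: "0 \<le> input_mass u a t"
    and input_mass_mono: "input_mass u a t \<le> input_mass u a b"
  unfolding input_mass_def
  by (rule integral_mono_interval[where b = b];
      use assms in \<open>auto simp: integrable_input_def intro!: absolutely_integrable_sum set_integrable_abs sum_nonneg\<close>)+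

lemma
  assumes "integrable_input a b u" "integrable_input a b v" "t \<in> {a..b}"
  shows input_dist_nonneg: "0 \<le> input_dist u v a t"
    and input_dist_mono: "input_dist u v a t \<le> input_dist u v a b"
  unfolding input_dist_def
  by (rule integral_mono_interval[where b = b];
      use assms in \<open>auto simp: integrable_input_def intro!: absolutely_integrable_sum set_integrable_abs
        set_integral_diff(1) sum_nonneg\<close>)+

text \<open>The factorial in the growth of the coefficients cancels the one gained by iterated integration.\<close>

lemma sum_norm_scaled_coeffs_le:
  fixes c :: "('m::finite, 'l::finite) series" and w :: "'m word \<Rightarrow> real"
  assumes c: "\<And>\<eta>. norm (c \<eta>) \<le> K * (M ^ length \<eta> * fact (length \<eta>))" and "M > 0" "K \<ge> 0"
    and w: "(\<Sum>\<eta> | length \<eta> = n. \<bar>w \<eta>\<bar>) \<le> r / fact n"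
  shows "(\<Sum>\<eta> | length \<eta> = n. norm (w \<eta> *\<^sub>R c \<eta>)) \<le> K * (M ^ n * r)"
proof -
  have "(\<Sum>\<eta> | length \<eta> = n. norm (w \<eta> *\<^sub>R c \<eta>)) \<le> (\<Sum>\<eta> | length \<eta> = n. \<bar>w \<eta>\<bar> * (K * (M ^ n * fact n)))"
  proof (rule sum_mono)
    fix \<eta> :: "'m word" assume "\<eta> \<in> {\<eta>. length \<eta> = n}"
    with c[of \<eta>] show "norm (w \<eta> *\<^sub>R c \<eta>) \<le> \<bar>w \<eta>\<bar> * (K * (M ^ n * fact n))"
      by (auto intro!: mult_left_mono)
  qed
  also have "\<dots> = (\<Sum>\<eta> | length \<eta> = n. \<bar>w \<eta>\<bar>) * (K * (M ^ n * fact n))" by (simp add: sum_distrib_right)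
  also have "\<dots> \<le> r / fact n * (K * (M ^ n * fact n))" using assms by (intro mult_right_mono w) auto
  finally show ?thesis by (simp add: mult_ac)
qed

lemma
  fixes c :: "('m::finite, 'l::finite) series"
  assumes c: "\<And>\<eta>. norm (c \<eta>) \<le> K * (M ^ length \<eta> * fact (length \<eta>))" and "M > 0" "K \<ge> 0"
    and u: "integrable_input a b u" and t: "t \<in> {a..b}"
    and \<rho>: "input_mass u a b \<le> \<rho>" "M * \<rho> < 1"
  shows chen_fliess_term_summable: "chen_fliess_term c u t a summable_on UNIV"
    and norm_chen_fliess_le: "norm (chen_fliess a c u t) \<le> K / (1 - M * \<rho>)"
proof -
  have m: "0 \<le> input_mass u a t" "input_mass u a t \<le> \<rho>"
    using input_mass_nonneg[OF u t] input_mass_mono[OF u t] \<rho> by auto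
  have "(\<Sum>\<eta> | length \<eta> = n. norm (chen_fliess_term c u t a \<eta>)) \<le> K * (M * \<rho>) ^ n" for n
  proof -
    have "(\<Sum>\<eta> | length \<eta> = n. norm (chen_fliess_term c u t a \<eta>)) \<le> K * (M ^ n * input_mass u a t ^ n)"
      unfolding chen_fliess_term_def input_mass_def using u t assms(1-3)
      by (intro sum_norm_scaled_coeffs_le iterated_integral_sum_le) (auto simp: integrable_input_def)
    also have "\<dots> \<le> K * (M ^ n * \<rho> ^ n)" using assms(2,3) m by (intro mult_left_mono power_mono) auto
    finally show ?thesis by (simp add: power_mult_distrib)
  qed
  moreover have "(\<lambda>n. K * (M * \<rho>) ^ n) sums (K * (1 / (1 - M * \<rho>)))"
    using assms(2) \<rho> m by (intro sums_mult geometric_sums) auto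
  ultimately have "chen_fliess_term c u t a summable_on UNIV \<and>
      norm (infsum (chen_fliess_term c u t a) UNIV) \<le> K * (1 / (1 - M * \<rho>))"
    by (intro conjI summable_on_words norm_infsum_words_le)
  then show "chen_fliess_term c u t a summable_on UNIV" "norm (chen_fliess a c u t) \<le> K / (1 - M * \<rho>)"
    by (simp_all add: chen_fliess_def)
qed

text \<open>This allows the bound at time \<open>t\<close> to be replaced by one that is uniform in \<open>t\<close>.\<close>

lemma power_diff_mono:
  fixes x y x' y' :: real
  assumes "0 \<le> x" "x \<le> x'" "0 \<le> y" "y \<le> y'"
  shows "(x + y) ^ n - x ^ n \<le> (x' + y') ^ n - x' ^ n"
proof (induction n)
  case (Suc n)
  have nn: "x ^ n \<le> (x + y) ^ n" using assms by (intro power_mono) auto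
  have "(x + y) ^ Suc n - x ^ Suc n = (x + y) * ((x + y) ^ n - x ^ n) + y * x ^ n" by (simp add: algebra_simps)
  also have "\<dots> \<le> (x' + y') * ((x' + y') ^ n - x' ^ n) + y' * x' ^ n"
    using assms Suc nn by (intro add_mono mult_mono power_mono) auto
  also have "\<dots> = (x' + y') ^ Suc n - x' ^ Suc n" by (simp add: algebra_simps)
  finally show ?case .
qed simp

lemma norm_chen_fliess_diff_input_le:
  fixes c :: "('m::finite, 'l::finite) series"
  assumes c: "\<And>\<eta>. norm (c \<eta>) \<le> K * (M ^ length \<eta> * fact (length \<eta>))" and "M > 0" "K \<ge> 0"
    and u: "integrable_input a b u" and v: "integrable_input a b v" and t: "t \<in> {a..b}"
    and \<rho>: "input_mass u a b \<le> \<rho>" "input_mass v a b \<le> \<rho>" "M * \<rho> < 1"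
    and \<delta>: "input_dist u v a b \<le> \<delta>" "M * (\<rho> + \<delta>) < 1"
  shows "norm (chen_fliess a c v t - chen_fliess a c u t) \<le> K * (1 / (1 - M * (\<rho> + \<delta>)) - 1 / (1 - M * \<rho>))"
proof -
  note summ = chen_fliess_term_summable[OF c assms(2,3) _ t]
  have m: "0 \<le> input_mass u a t" "input_mass u a t \<le> \<rho>"
    using input_mass_nonneg[OF u t] input_mass_mono[OF u t] \<rho> by auto
  have d: "0 \<le> input_dist u v a t" "input_dist u v a t \<le> \<delta>"
    using input_dist_nonneg[OF u v t] input_dist_mono[OF u v t] \<delta> by auto
  let ?f = "\<lambda>\<eta>. (iterated_integral \<eta> v t a - iterated_integral \<eta> u t a) *\<^sub>R c \<eta>"
  have "(\<Sum>\<eta> | length \<eta> = n. norm (?f \<eta>)) \<le> K * ((M * (\<rho> + \<delta>)) ^ n - (M * \<rho>) ^ n)" for n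
  proof -
    have "(\<Sum>\<eta> | length \<eta> = n. norm (?f \<eta>))
        \<le> K * (M ^ n * ((input_mass u a t + input_dist u v a t) ^ n - input_mass u a t ^ n))"
      unfolding input_mass_def input_dist_def using u v t assms(1-3)
      by (intro sum_norm_scaled_coeffs_le iterated_integral_diff_sum_le) (auto simp: integrable_input_def)
    also have "\<dots> \<le> K * (M ^ n * ((\<rho> + \<delta>) ^ n - \<rho> ^ n))"
      using assms(2,3) m d by (intro mult_left_mono power_diff_mono) auto
    finally show ?thesis by (simp add: power_mult_distrib right_diff_distrib)
  qed
  moreover have "(\<lambda>n. K * ((M * (\<rho> + \<delta>)) ^ n - (M * \<rho>) ^ n))
      sums (K * (1 / (1 - M * (\<rho> + \<delta>)) - 1 / (1 - M * \<rho>)))"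
    using assms(2) \<rho> \<delta> m d by (intro sums_mult sums_diff geometric_sums) auto
  ultimately have "norm (infsum ?f UNIV) \<le> K * (1 / (1 - M * (\<rho> + \<delta>)) - 1 / (1 - M * \<rho>))"
    by (rule norm_infsum_words_le)
  moreover have "infsum ?f UNIV = chen_fliess a c v t - chen_fliess a c u t"
  proof -
    have "((\<lambda>\<eta>. chen_fliess_term c v t a \<eta> + - chen_fliess_term c u t a \<eta>) has_sum
        (chen_fliess a c v t + - chen_fliess a c u t)) UNIV"
      unfolding chen_fliess_def using summ[OF u \<rho>(1,3)] summ[OF v \<rho>(2,3)]
      by (intro has_sum_add has_sum_infsum) (simp_all add: has_sum_uminus)
    then show ?thesis
      by (intro infsumI) (simp add: chen_fliess_term_def scaleR_diff_left)
  qed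
  ultimately show ?thesis by simp
qed

lemma measurable_chen_fliess:
  fixes c :: "('m::finite, 'l::finite) series"
  assumes u: "integrable_input a b u"
    and summ: "\<And>t. t \<in> {a..b} \<Longrightarrow> chen_fliess_term c u t a summable_on UNIV"
  shows "chen_fliess a c u \<in> borel_measurable (lebesgue_on {a..b})"
proof (rule borel_measurable_LIMSEQ_metric)
  show "(\<lambda>t. \<Sum>\<eta> | length \<eta> \<le> n. chen_fliess_term c u t a \<eta>) \<in> borel_measurable (lebesgue_on {a..b})" for n
    unfolding chen_fliess_term_def using u
    by (intro continuous_imp_measurable_on_sets_lebesgue continuous_intros continuous_iterated_integral)
       (auto simp: integrable_input_def)
  fix t assume "t \<in> space (lebesgue_on {a..b})"
  then have "(sum (chen_fliess_term c u t a) \<longlongrightarrow> chen_fliess a c u t) (finite_subsets_at_top UNIV)"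
    using summ[of t] has_sum_infsum unfolding chen_fliess_def has_sum_def by force
  from filterlim_compose[OF this filterlim_words_length_le]
  show "(\<lambda>n. \<Sum>\<eta> | length \<eta> \<le> n. chen_fliess_term c u t a \<eta>) \<longlonglongrightarrow> chen_fliess a c u t" .
qed

section \<open>Hoelder's inequality on an interval\<close>

lemma conjugate_exponent_cases:
  fixes p q :: ennreal
  assumes "1 \<le> p" "1 / p + 1 / q = 1"
  obtains "p = \<infinity>" "enn2real (1 / q) = 1"
  | r where "p = ennreal r" "1 \<le> r" "enn2real (1 / q) = 1 - 1 / r"
proof (cases p)
  case top
  then have "1 / q = 1" using assms by simp
  then show ?thesis using that(1) top by simp
next
  case (real r)
  then have r: "1 \<le> r" using assms(1) by (simp flip: ennreal_1)
  have p: "1 / p = ennreal (1 / r)"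
    using divide_ennreal[of 1 r] r real by simp
  then have "1 / q \<noteq> top" using assms(2) by (auto simp: top_unique)
  then obtain s where s: "1 / q = ennreal s" "0 \<le> s" by (cases "1 / q") auto
  then have "ennreal (1 / r + s) = ennreal 1" using assms(2) p r by simp
  then have "1 / r + s = 1" using s r by (subst (asm) ennreal_inj) auto
  then show ?thesis using that(2)[of r] real r s by simp
qed

lemma emeasure_lebesgue_on_Icc: "a \<le> b \<Longrightarrow> emeasure (lebesgue_on {a..b}) {a..b} = ennreal (b - a)"
  by (simp add: emeasure_restrict_space)

text \<open>
  The tangent-line bound for \<open>x\<^sup>r\<close> at the point \<open>w = s L\<^bsup>-1/r\<^esup>\<close>, the constant function on an
  interval of length \<open>L\<close> with \<open>L\<^sub>r\<close>-norm \<open>s\<close>. Integrating it gives Hoelder's inequality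
  against the constant function 1, with the sharp constant.
\<close>

lemma weighted_young:
  fixes x s L r :: real
  assumes "0 \<le> x" "0 < s" "0 < L" "1 \<le> r"
  shows "x \<le> s powr (1 - r) * L powr (1 - 1 / r) / r * x powr r + (1 - 1 / r) * s * L powr (- 1 / r)"
proof (cases "x = 0")
  case True
  then show ?thesis using assms by (simp add: divide_simps)
next
  case False
  define w where "w = s * L powr (- 1 / r)"
  have w: "w > 0" using assms by (simp add: w_def)
  have "((x / w) powr r) powr (1 / r) * 1 powr (1 - 1 / r) \<le> 1 / r * (x / w) powr r + (1 - 1 / r) * 1"
    using assms False w by (intro Youngs_inequality_0) (auto simp: divide_simps)
  then have "x / w \<le> 1 / r * (x / w) powr r + (1 - 1 / r)"
    using assms w False by (simp add: powr_powr)
  then have "x \<le> (1 / r * (x / w) powr r + (1 - 1 / r)) * w"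
    using w by (simp add: pos_divide_le_eq)
  also have "\<dots> = w powr (1 - r) / r * x powr r + (1 - 1 / r) * w"
    using w assms False by (simp add: powr_divide powr_diff field_simps)
  also have "w powr (1 - r) = s powr (1 - r) * L powr (1 - 1 / r)"
  proof -
    have "- 1 / r * (1 - r) = 1 - 1 / r" using assms by (simp add: field_simps)
    then show ?thesis using assms by (simp add: w_def powr_mult powr_powr)
  qed
  finally show ?thesis by (simp add: w_def mult.assoc)
qed

lemma Lp_norm1_finite_exponent_le:
  assumes "Lp_norm1 (ennreal r) a b f \<le> ennreal s" "1 \<le> r" "0 \<le> s"
  shows "(\<integral>\<^sup>+ t. ennreal (\<bar>f t\<bar> powr r) \<partial>lebesgue_on {a..b}) \<le> ennreal (s powr r)"
proof -
  define I where "I = (\<integral>\<^sup>+ t. ennreal (\<bar>f t\<bar> powr r) \<partial>lebesgue_on {a..b})"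
  have "Lp_norm1 (ennreal r) a b f = (if I = \<infinity> then \<infinity> else ennreal (enn2real I powr (1 / r)))"
    using assms(2) by (simp add: Lp_norm1_def I_def Let_def)
  then have *: "(if I = \<infinity> then \<infinity> else ennreal (enn2real I powr (1 / r))) \<le> ennreal s"
    using assms(1) by simp
  then have fin: "I \<noteq> \<infinity>" by (auto simp: top_unique split: if_splits)
  then have "enn2real I powr (1 / r) \<le> s" using * assms by simp
  then have "(enn2real I powr (1 / r)) powr r \<le> s powr r" using assms by (intro powr_mono2) auto
  then have "enn2real I \<le> s powr r" using assms by (simp add: powr_powr)
  then show ?thesis using enn2real_le[of I] fin by (simp add: I_def)
qed

text \<open>Hoelder's inequality against the constant function 1.\<close>

lemma Hoelder_nn_integral:
  assumes p: "1 \<le> p" "1 / p + 1 / q = 1" and "a < b" "0 < s"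
    and f: "f \<in> borel_measurable (lebesgue_on {a..b})" and le: "Lp_norm1 p a b f \<le> ennreal s"
  shows "(\<integral>\<^sup>+ t. ennreal \<bar>f t\<bar> \<partial>lebesgue_on {a..b}) \<le> ennreal (s * (b - a) powr enn2real (1 / q))"
  using p
proof (cases rule: conjugate_exponent_cases)
  case 1
  have "AE t in lebesgue_on {a..b}. ennreal \<bar>f t\<bar> \<le> esssup (lebesgue_on {a..b}) (\<lambda>t. ennreal \<bar>f t\<bar>)"
    by (rule esssup_AE)
  then have "AE t in lebesgue_on {a..b}. ennreal \<bar>f t\<bar> \<le> ennreal s"
    by (rule eventually_mono) (use le 1 in \<open>auto simp: Lp_norm1_def intro: order_trans\<close>)
  then have "(\<integral>\<^sup>+ t. ennreal \<bar>f t\<bar> \<partial>lebesgue_on {a..b}) \<le> (\<integral>\<^sup>+ t. ennreal s \<partial>lebesgue_on {a..b})"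
    by (rule nn_integral_mono_AE)
  also have "\<dots> = ennreal (s * (b - a))"
    using assms by (simp add: emeasure_lebesgue_on_Icc ennreal_mult)
  finally show ?thesis using 1 assms by simp
next
  case (2 r)
  define L where "L = b - a"
  define A where "A = s powr (1 - r) * L powr (1 - 1 / r) / r"
  define B where "B = (1 - 1 / r) * s * L powr (- 1 / r)"
  have L: "L > 0" using assms by (simp add: L_def)
  have AB: "A \<ge> 0" "B \<ge> 0" using 2 assms L by (auto simp: A_def B_def divide_simps)
  have f': "(\<lambda>t. ennreal (\<bar>f t\<bar> powr r)) \<in> borel_measurable (lebesgue_on {a..b})"
    using f by measurable
  have "(\<integral>\<^sup>+ t. ennreal \<bar>f t\<bar> \<partial>lebesgue_on {a..b})
      \<le> (\<integral>\<^sup>+ t. ennreal A * ennreal (\<bar>f t\<bar> powr r) + ennreal B \<partial>lebesgue_on {a..b})"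
    using weighted_young[of "\<bar>f _\<bar>" s L r] 2 assms L AB
    by (intro nn_integral_mono) (simp add: A_def B_def flip: ennreal_mult ennreal_plus)
  also have "\<dots> = ennreal A * (\<integral>\<^sup>+ t. ennreal (\<bar>f t\<bar> powr r) \<partial>lebesgue_on {a..b}) + ennreal B * ennreal L"
    using assms f' by (simp add: nn_integral_add nn_integral_cmult emeasure_lebesgue_on_Icc L_def)
  also have "\<dots> \<le> ennreal A * ennreal (s powr r) + ennreal B * ennreal L"
    using Lp_norm1_finite_exponent_le[of r a b f s] le 2 assms by (intro add_right_mono mult_left_mono) auto
  also have "\<dots> = ennreal (A * s powr r + B * L)"
    using AB L by (simp add: ennreal_mult)
  also have "A * s powr r + B * L = s * L powr (1 - 1 / r)"
  proof -
    have "s powr (1 - r) * s powr r = s" using assms by (simp flip: powr_add)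
    then have "A * s powr r = s * L powr (1 - 1 / r) / r" by (simp add: A_def)
    moreover have "L powr (- 1 / r) * L = L powr (1 - 1 / r)"
      using powr_add[of L "- 1 / r" 1] L by (simp add: algebra_simps)
    then have "B * L = (1 - 1 / r) * (s * L powr (1 - 1 / r))" by (simp add: B_def mult.assoc)
    ultimately show ?thesis by (simp add: algebra_simps)
  qed
  finally show ?thesis using 2 by (simp add: L_def)
qed

lemma
  assumes "1 \<le> p" "1 / p + 1 / q = 1" "a < b" "0 < s"
    and f: "f \<in> borel_measurable (lebesgue_on {a..b})" and "Lp_norm1 p a b f \<le> ennreal s"
  shows absolutely_integrable_of_Lp_norm1: "f absolutely_integrable_on {a..b}"
    and Hoelder_integral: "integral {a..b} (\<lambda>t. \<bar>f t\<bar>) \<le> s * (b - a) powr enn2real (1 / q)"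
proof -
  have le: "(\<integral>\<^sup>+ t. ennreal \<bar>f t\<bar> \<partial>lebesgue_on {a..b}) \<le> ennreal (s * (b - a) powr enn2real (1 / q))"
    by (rule Hoelder_nn_integral[OF assms])
  then have int: "integrable (lebesgue_on {a..b}) f"
    using f by (intro integrableI_bounded) (auto simp: less_top[symmetric] top_unique)
  then show "f absolutely_integrable_on {a..b}"
    by (simp add: absolutely_integrable_measurable_real f integrable_abs)
  have "integral {a..b} (\<lambda>t. \<bar>f t\<bar>) = (LINT t|lebesgue_on {a..b}. \<bar>f t\<bar>)"
    using int by (intro lebesgue_integral_eq_integral[symmetric]) auto
  also have "\<dots> = enn2real (\<integral>\<^sup>+ t. ennreal \<bar>f t\<bar> \<partial>lebesgue_on {a..b})"
    using f by (intro integral_eq_nn_integral) auto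
  also have "\<dots> \<le> s * (b - a) powr enn2real (1 / q)"
    using le assms by (intro enn2real_leI) auto
  finally show "integral {a..b} (\<lambda>t. \<bar>f t\<bar>) \<le> s * (b - a) powr enn2real (1 / q)" .
qed

lemma Lp_norm1_le_bound:
  assumes "1 \<le> q" "a < b" "0 \<le> K" and f: "f \<in> borel_measurable (lebesgue_on {a..b})"
    and le: "\<And>t. t \<in> {a..b} \<Longrightarrow> \<bar>f t\<bar> \<le> K"
  shows "Lp_norm1 q a b f \<le> ennreal (K * (b - a) powr enn2real (1 / q))"
proof (cases q)
  case top
  have "esssup (lebesgue_on {a..b}) (\<lambda>t. ennreal \<bar>f t\<bar>) \<le> ennreal K"
    using f le by (intro esssup_I) (auto intro!: AE_I2 ennreal_leI)
  then show ?thesis using top assms by (simp add: Lp_norm1_def)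
next
  case (real r)
  then have r: "1 \<le> r" using assms(1) by (simp flip: ennreal_1)
  have e: "enn2real (1 / q) = 1 / r" using divide_ennreal[of 1 r] r real by simp
  define I where "I = (\<integral>\<^sup>+ t. ennreal (\<bar>f t\<bar> powr r) \<partial>lebesgue_on {a..b})"
  have "I \<le> (\<integral>\<^sup>+ t. ennreal (K powr r) \<partial>lebesgue_on {a..b})"
    unfolding I_def using le r by (intro nn_integral_mono ennreal_leI powr_mono2) auto
  also have "\<dots> = ennreal (K powr r * (b - a))"
    using assms by (simp add: emeasure_lebesgue_on_Icc ennreal_mult)
  finally have I: "I \<le> ennreal (K powr r * (b - a))" .
  then have "enn2real I \<le> K powr r * (b - a)" using assms by (intro enn2real_leI) auto
  then have "enn2real I powr (1 / r) \<le> (K powr r * (b - a)) powr (1 / r)"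
    using r by (intro powr_mono2) auto
  also have "\<dots> = K * (b - a) powr (1 / r)" using assms r by (simp add: powr_mult powr_powr)
  finally show ?thesis
    using I real r e by (auto simp: Lp_norm1_def Let_def top_unique simp flip: I_def intro: ennreal_leI)
qed

lemma measurable_vec_nth_comp:
  "f \<in> borel_measurable M \<Longrightarrow> (\<lambda>t. f t $ i :: real) \<in> borel_measurable M"
  by (rule measurable_compose[where g = "\<lambda>x. x $ i"])
     (auto intro!: borel_measurable_continuous_onI continuous_intros)

lemma Lp_norm_le_iff: "Lp_norm p a b u \<le> s \<longleftrightarrow> (\<forall>i. Lp_norm1 p a b (\<lambda>t. u t $ i) \<le> s)"
  by (auto simp: Lp_norm_def)

lemma Lp_norm_le_bound:
  fixes f :: "real \<Rightarrow> real^'n"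
  assumes "1 \<le> q" "a < b" and f: "f \<in> borel_measurable (lebesgue_on {a..b})"
    and le: "\<And>t. t \<in> {a..b} \<Longrightarrow> norm (f t) \<le> K"
  shows "Lp_norm q a b f \<le> ennreal (K * (b - a) powr enn2real (1 / q))"
proof -
  have "0 \<le> K" using le[of a] assms(2) norm_ge_zero[of "f a"] by (simp del: norm_ge_zero)
  then show ?thesis unfolding Lp_norm_le_iff
    using assms component_le_norm_cart order_trans
    by (intro allI Lp_norm1_le_bound measurable_vec_nth_comp) (blast | simp)+
qed

section \<open>Inputs bounded in the Lebesgue norm\<close>

lemma
  fixes u :: "real \<Rightarrow> real^'m::finite"
  assumes p: "1 \<le> p" "1 / p + 1 / q = 1" "a < b" "0 < s"
    and u: "u \<in> borel_measurable (lebesgue_on {a..b})" "Lp_norm p a b u \<le> ennreal s"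
  shows integrable_input_of_Lp: "integrable_input a b u"
    and sum_integral_components_le:
      "(\<Sum>i\<in>UNIV. integral {a..b} (\<lambda>t. \<bar>u t $ i\<bar>)) \<le> CARD('m) * (s * (b - a) powr enn2real (1 / q))"
proof -
  have int: "(\<lambda>t. u t $ i) absolutely_integrable_on {a..b}"
    and le: "integral {a..b} (\<lambda>t. \<bar>u t $ i\<bar>) \<le> s * (b - a) powr enn2real (1 / q)" for i
    using u(2) unfolding Lp_norm_le_iff
    by (auto intro!: absolutely_integrable_of_Lp_norm1[OF p] Hoelder_integral[OF p]
        measurable_vec_nth_comp u(1))
  have "input u x absolutely_integrable_on {a..b}" for x
    using int by (cases x) (auto simp: fun_eq_iff[of "input u _"] cong: set_integrable_cong)
  then show "integrable_input a b u" by (simp add: integrable_input_def)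
  show "(\<Sum>i\<in>UNIV. integral {a..b} (\<lambda>t. \<bar>u t $ i\<bar>)) \<le> CARD('m) * (s * (b - a) powr enn2real (1 / q))"
    by (rule order_trans[OF sum_mono[OF le]]) simp
qed

lemma sum_UNIV_option: "(\<Sum>x\<in>UNIV. f x) = f None + (\<Sum>i\<in>UNIV. f (Some i))"
  for f :: "'a::finite option \<Rightarrow> 'b::comm_monoid_add"
  by (simp add: UNIV_option_conv sum.reindex)

lemma input_mass_le:
  fixes u :: "real \<Rightarrow> real^'m::finite"
  assumes "1 \<le> p" "1 / p + 1 / q = 1" "a < b" "0 < s"
    and "u \<in> borel_measurable (lebesgue_on {a..b})" "Lp_norm p a b u \<le> ennreal s"
  shows "input_mass u a b \<le> (b - a) + CARD('m) * (s * (b - a) powr enn2real (1 / q))"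
proof -
  have int: "input u x absolutely_integrable_on {a..b}" for x
    using integrable_input_of_Lp[OF assms] by (simp add: integrable_input_def)
  have "input_mass u a b = (\<Sum>x\<in>UNIV. integral {a..b} (\<lambda>\<tau>. \<bar>input u x \<tau>\<bar>))"
    unfolding input_mass_def using int
    by (intro Henstock_Kurzweil_Integration.integral_sum
        set_lebesgue_integral_eq_integral(1) set_integrable_abs) auto
  also have "\<dots> = (b - a) + (\<Sum>i\<in>UNIV. integral {a..b} (\<lambda>t. \<bar>u t $ i\<bar>))"
    using assms(3) by (simp add: sum_UNIV_option)
  finally show ?thesis using sum_integral_components_le[OF assms] by simp
qed

lemma input_dist_le:
  fixes u v :: "real \<Rightarrow> real^'m::finite"
  assumes "1 \<le> p" "1 / p + 1 / q = 1" "a < b" "0 < s"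
    and "(v - u) \<in> borel_measurable (lebesgue_on {a..b})" "Lp_norm p a b (v - u) \<le> ennreal s"
  shows "input_dist u v a b \<le> CARD('m) * (s * (b - a) powr enn2real (1 / q))"
proof -
  have int: "input (v - u) x absolutely_integrable_on {a..b}" for x
    using integrable_input_of_Lp[OF assms] by (simp add: integrable_input_def)
  have "(\<lambda>\<tau>. input v (Some i) \<tau> - input u (Some i) \<tau>) absolutely_integrable_on {a..b}" for i
    using int[of "Some i"] by (simp cong: set_integrable_cong)
  then have int': "(\<lambda>\<tau>. input v x \<tau> - input u x \<tau>) absolutely_integrable_on {a..b}" for x
    by (cases x) (simp_all cong: set_integrable_cong)
  have "input_dist u v a b = (\<Sum>x\<in>UNIV. integral {a..b} (\<lambda>\<tau>. \<bar>input v x \<tau> - input u x \<tau>\<bar>))"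
    unfolding input_dist_def using int'
    by (intro Henstock_Kurzweil_Integration.integral_sum
        set_lebesgue_integral_eq_integral(1) set_integrable_abs) auto
  also have "\<dots> = (\<Sum>i\<in>UNIV. integral {a..b} (\<lambda>t. \<bar>(v - u) t $ i\<bar>))"
    by (simp add: sum_UNIV_option)
  finally show ?thesis using sum_integral_components_le[OF assms] by simp
qed

section \<open>Coefficient norms and linearity\<close>

lemma linf_norm_le_iff:
  assumes "M > 0" "k \<ge> 0"
  shows "linf_norm M c \<le> ennreal k \<longleftrightarrow> (\<forall>\<eta>. infnorm (c \<eta>) \<le> k * (M ^ length \<eta> * fact (length \<eta>)))"
  using assms by (auto simp: linf_norm_def SUP_le_iff ennreal_le_iff divide_le_eq)

lemma linf_norm_triangle:
  fixes c d :: "('m, 'l::finite) series"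
  assumes "M > 0"
  shows "linf_norm M (c + d) \<le> linf_norm M c + linf_norm M d"
proof (cases "linf_norm M c = top \<or> linf_norm M d = top")
  case False
  then obtain k l where kl: "linf_norm M c = ennreal k" "k \<ge> 0" "linf_norm M d = ennreal l" "l \<ge> 0"
    by (metis ennreal_cases)
  have "infnorm ((c + d) \<eta>) \<le> (k + l) * (M ^ length \<eta> * fact (length \<eta>))" for \<eta>
  proof -
    have "infnorm ((c + d) \<eta>) \<le> infnorm (c \<eta>) + infnorm (d \<eta>)"
      by (simp add: infnorm_triangle)
    also have "\<dots> \<le> k * (M ^ length \<eta> * fact (length \<eta>)) + l * (M ^ length \<eta> * fact (length \<eta>))"
      using kl assms linf_norm_le_iff[of M k c] linf_norm_le_iff[of M l d] by (intro add_mono) auto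
    finally show ?thesis by (simp add: distrib_right)
  qed
  then have "linf_norm M (c + d) \<le> ennreal (k + l)"
    using linf_norm_le_iff[of M "k + l" "c + d"] assms kl by auto
  then show ?thesis using kl by simp
qed auto

text \<open>
  The estimates above use the Euclidean norm on the coefficients, while the series norm uses the
  maximum norm; this costs the factor \<open>\<surd>\<ell>\<close>.
\<close>

lemma coeff_bound:
  fixes c :: "('m, 'l::finite) series"
  assumes "M > 0" "k \<ge> 0" "linf_norm M c \<le> ennreal k"
  shows "norm (c \<eta>) \<le> sqrt CARD('l) * k * (M ^ length \<eta> * fact (length \<eta>))"
proof -
  have "norm (c \<eta>) \<le> sqrt CARD('l) * infnorm (c \<eta>)" using norm_le_infnorm[of "c \<eta>"] by simp
  also have "\<dots> \<le> sqrt CARD('l) * (k * (M ^ length \<eta> * fact (length \<eta>)))"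
    using assms linf_norm_le_iff[of M k c] by (intro mult_left_mono) auto
  finally show ?thesis by (simp add: mult.assoc)
qed

lemma chen_fliess_add:
  assumes "chen_fliess_term c u t a summable_on UNIV" "chen_fliess_term d u t a summable_on UNIV"
  shows "chen_fliess a (c + d) u t = chen_fliess a c u t + chen_fliess a d u t"
  using infsum_add[OF assms] by (simp add: chen_fliess_def chen_fliess_term_def[abs_def] scaleR_add_right)

lemma chen_fliess_scaleR:
  "chen_fliess a (\<lambda>\<eta>. r *\<^sub>R c \<eta>) u t = r *\<^sub>R chen_fliess a c u t"
  using infsum_scaleR_right[of r "chen_fliess_term c u t a" UNIV]
  by (simp add: chen_fliess_def chen_fliess_term_def[abs_def] mult.commute)

lemma input_dist_triangle:
  assumes "integrable_input a b u" "integrable_input a b v" "integrable_input a b w"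
  shows "input_dist u w a b \<le> input_dist u v a b + input_dist v w a b"
proof -
  have int: "(\<lambda>\<tau>. \<Sum>x\<in>UNIV. \<bar>input y x \<tau> - input z x \<tau>\<bar>) integrable_on {a..b}"
    if "integrable_input a b y" "integrable_input a b z" for y z :: "real \<Rightarrow> real^'a"
    using that unfolding integrable_input_def
    by (intro set_lebesgue_integral_eq_integral(1) absolutely_integrable_sum
        set_integrable_abs set_integral_diff(1)) auto
  have "input_dist u w a b \<le> integral {a..b} (\<lambda>\<tau>. (\<Sum>x\<in>UNIV. \<bar>input v x \<tau> - input u x \<tau>\<bar>)
      + (\<Sum>x\<in>UNIV. \<bar>input w x \<tau> - input v x \<tau>\<bar>))"
    unfolding input_dist_def using assms int
    by (intro integral_le integrable_add) (auto simp flip: sum.distrib intro!: sum_mono)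
  then show ?thesis
    unfolding input_dist_def using assms int
    by (simp add: Henstock_Kurzweil_Integration.integral_add)
qed

lemma small_geometric_increment:
  fixes M \<rho> K \<epsilon> :: real
  assumes "M * \<rho> < 1" "\<epsilon> > 0"
  obtains \<delta> where "\<delta> > 0" "M * (\<rho> + \<delta>) < 1" "K * (1 / (1 - M * (\<rho> + \<delta>)) - 1 / (1 - M * \<rho>)) \<le> \<epsilon>"
proof -
  have "((\<lambda>\<delta>. M * (\<rho> + \<delta>)) \<longlongrightarrow> M * (\<rho> + 0)) (at_right 0)" by (intro tendsto_intros)
  then have "\<forall>\<^sub>F \<delta> in at_right 0. M * (\<rho> + \<delta>) < 1" using assms by (intro order_tendstoD(2)) auto
  moreover have "((\<lambda>\<delta>. K * (1 / (1 - M * (\<rho> + \<delta>)) - 1 / (1 - M * \<rho>))) \<longlongrightarrow>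
      K * (1 / (1 - M * (\<rho> + 0)) - 1 / (1 - M * \<rho>))) (at_right 0)"
    using assms by (intro tendsto_intros) auto
  then have "\<forall>\<^sub>F \<delta> in at_right 0. K * (1 / (1 - M * (\<rho> + \<delta>)) - 1 / (1 - M * \<rho>)) < \<epsilon>"
    using assms by (intro order_tendstoD(2)) auto
  moreover have "\<forall>\<^sub>F \<delta> :: real in at_right 0. \<delta> > 0" by (rule eventually_at_right_less)
  ultimately have "\<forall>\<^sub>F \<delta> in at_right 0. \<delta> > 0 \<and> M * (\<rho> + \<delta>) < 1 \<and>
      K * (1 / (1 - M * (\<rho> + \<delta>)) - 1 / (1 - M * \<rho>)) < \<epsilon>"
    by eventually_elim simp
  then show ?thesis using that
    by (metis (no_types, lifting) eventually_happens' less_imp_le trivial_limit_at_right_real)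
qed

section \<open>Continuity for seminorm topologies\<close>

lemma ennreal_less_obtain_real:
  assumes "0 < (e :: ennreal)"
  obtains \<epsilon> where "\<epsilon> > 0" "ennreal \<epsilon> < e"
proof -
  obtain y where y: "0 < y" "y < e" using dense[OF assms] by blast
  then have "y < top" by (auto intro: less_le_trans)
  with y that[of "enn2real y"] show ?thesis by (simp add: enn2real_positive_iff)
qed

text \<open>
  The \<open>\<epsilon>\<close>-\<open>\<delta>\<close> criterion needs no triangle inequality for the functionals \<open>N\<close> and \<open>N'\<close>, because open sets
  are defined by balls around each of their points.
\<close>

lemma continuous_map_seminorm_topologyI:
  assumes "f \<in> S \<rightarrow> S'"
    and cont: "\<And>x \<epsilon>. x \<in> S \<Longrightarrow> \<epsilon> > 0 \<Longrightarrow> \<exists>\<delta>>0. \<forall>y\<in>S. N (y - x) < \<delta> \<longrightarrow> N' (f y - f x) \<le> ennreal \<epsilon>"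
  shows "continuous_map (seminorm_topology S N) (seminorm_topology S' N') f"
  unfolding continuous_map_def
proof (intro conjI allI impI)
  show "f \<in> topspace (seminorm_topology S N) \<rightarrow> topspace (seminorm_topology S' N')"
    using assms(1) by simp
  fix U assume U: "openin (seminorm_topology S' N') U"
  show "openin (seminorm_topology S N) {x \<in> topspace (seminorm_topology S N). f x \<in> U}"
    unfolding openin_seminorm_topology topspace_seminorm_topology
  proof (intro conjI ballI)
    fix x assume x: "x \<in> {x \<in> S. f x \<in> U}"
    with U obtain e where e: "e > 0" "\<forall>y\<in>S'. N' (y - f x) < e \<longrightarrow> y \<in> U"
      unfolding openin_seminorm_topology by blast
    obtain \<epsilon> where \<epsilon>: "\<epsilon> > 0" "ennreal \<epsilon> < e" using ennreal_less_obtain_real[OF e(1)] by metis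
    obtain \<delta> where "\<delta> > 0" "\<forall>y\<in>S. N (y - x) < \<delta> \<longrightarrow> N' (f y - f x) \<le> ennreal \<epsilon>"
      using cont[of x \<epsilon>] x \<epsilon> by auto
    then show "\<exists>d>0. \<forall>y\<in>S. N (y - x) < d \<longrightarrow> y \<in> {x \<in> S. f x \<in> U}"
      using e(2) \<epsilon>(2) assms(1) by (intro exI[of _ \<delta>]) (auto intro: le_less_trans)
  qed auto
qed

section \<open>Continuity of the Chen-Fliess operator\<close>

theorem theorem4p6:
  fixes M R T t0 :: real and p q :: ennreal
  assumes "M > 0"
    and "1 \<le> p" and "1 \<le> q" and "1 / p + 1 / q = 1"
    and "0 < T" and "T \<le> R" and "R < 1 / (M * (real CARD('m::finite) + 1))"
    and "M * (T + real CARD('m) * (R * T powr enn2real (1 / q))) < 1"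
  shows
    "let V = (linf M :: ('m, 'l::finite) series set);
         NV = (linf_norm M :: ('m, 'l) series \<Rightarrow> ennreal);
         B = (Lp_ball p R t0 (t0 + T) :: (real \<Rightarrow> real^'m) set);
         NB = (Lp_norm p t0 (t0 + T) :: (real \<Rightarrow> real^'m) \<Rightarrow> ennreal);
         W = (Lp_space q t0 (t0 + T) :: (real \<Rightarrow> real^'l) set);
         NW = (Lp_norm q t0 (t0 + T) :: (real \<Rightarrow> real^'l) \<Rightarrow> ennreal)
     in (\<forall>c\<in>V. \<forall>u\<in>B. \<forall>t\<in>{t0..t0 + T}. chen_fliess_term c u t t0 summable_on UNIV) \<and>
        continuous_map
          (seminorm_topology V NV)
          (seminorm_topology (BC B NB W NW) (sup_norm B NW))
          (\<lambda>c u. chen_fliess t0 c u) \<and>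
        continuous_map
          (seminorm_topology B NB)
          (seminorm_topology (bounded_lin V NV W NW) (op_norm V NV NW))
          (\<lambda>u c. chen_fliess t0 c u) \<and>
        continuous_map
          (prod_topology (seminorm_topology V NV) (seminorm_topology B NB))
          (seminorm_topology W NW)
          (\<lambda>(c, u). chen_fliess t0 c u)"
proof -
  define V where "V = (linf M :: ('m, 'l) series set)"
  define NV where "NV = (linf_norm M :: ('m, 'l) series \<Rightarrow> ennreal)"
  define b where "b = t0 + T"
  define B where "B = (Lp_ball p R t0 b :: (real \<Rightarrow> real^'m) set)"
  define NB where "NB = (Lp_norm p t0 b :: (real \<Rightarrow> real^'m) \<Rightarrow> ennreal)"
  define W where "W = (Lp_space q t0 b :: (real \<Rightarrow> real^'l) set)"
  define NW where "NW = (Lp_norm q t0 b :: (real \<Rightarrow> real^'l) \<Rightarrow> ennreal)"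
  define \<Lambda> where "\<Lambda> = T powr enn2real (1 / q)"
  define \<rho> where "\<rho> = T + CARD('m) * (R * \<Lambda>)"
  define C where "C = sqrt (real CARD('l))"
  have b: "t0 < b" "b - t0 = T" using assms(5) by (simp_all add: b_def)
  have R: "R > 0" and \<Lambda>: "\<Lambda> > 0" using assms by (simp_all add: \<Lambda>_def)
  have C: "C > 0" by (simp add: C_def)
  have \<rho>: "M * \<rho> < 1" using assms(8) by (simp add: \<rho>_def \<Lambda>_def)
  note Mpos = assms(1) and conj = assms(2,4)
  \<comment> \<open>Hoelder's inequality is used only in the next two steps.\<close>
  have inp: "integrable_input t0 b u" "input_mass u t0 b \<le> \<rho>" if "u \<in> B" for u
    using that integrable_input_of_Lp[OF conj b(1) R] input_mass_le[OF conj b(1) R]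
    by (auto simp: B_def Lp_ball_def Lp_space_def \<rho>_def \<Lambda>_def b)
  have dist: "input_dist u v t0 b \<le> CARD('m) * (s * \<Lambda>)"
    if "u \<in> B" "v \<in> B" "NB (v - u) \<le> ennreal s" "s > 0" for u v s
    using that input_dist_le[OF conj b(1) that(4), of v u]
    by (auto simp: B_def NB_def Lp_ball_def Lp_space_def \<Lambda>_def b fun_diff_def)
  have dist_small: "\<exists>s>0. \<forall>u\<in>B. \<forall>v\<in>B. NB (v - u) < ennreal s \<longrightarrow> input_dist u v t0 b \<le> \<delta>" if "\<delta> > 0" for \<delta>
  proof (intro exI[of _ "\<delta> / (CARD('m) * \<Lambda>)"] conjI ballI impI)
    fix u v assume *: "u \<in> B" "v \<in> B" "NB (v - u) < ennreal (\<delta> / (CARD('m) * \<Lambda>))"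
    show "input_dist u v t0 b \<le> \<delta>"
      using dist[OF *(1,2) less_imp_le[OF *(3)]] that \<Lambda> by simp
  qed (use that \<Lambda> in simp)
  have V_obtain: "\<exists>k\<ge>0. NV c \<le> ennreal k" if "c \<in> V" for c
    using that unfolding V_def NV_def linf_def by (cases "linf_norm M c") auto
  have V_of: "c \<in> V" if "NV c \<le> ennreal k" for c k
    using that unfolding V_def NV_def linf_def by (auto intro: le_less_trans)
  have coeff: "norm (c \<eta>) \<le> C * k * (M ^ length \<eta> * fact (length \<eta>))" if "NV c \<le> ennreal k" "k \<ge> 0" for c k \<eta>
    using coeff_bound[of M k c] that Mpos by (simp add: NV_def C_def)
  have summ: "chen_fliess_term c u t t0 summable_on UNIV" if "c \<in> V" "u \<in> B" "t \<in> {t0..b}" for c u t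
  proof -
    obtain k where k: "k \<ge> 0" "NV c \<le> ennreal k" using V_obtain[OF \<open>c \<in> V\<close>] by blast
    show ?thesis
      by (rule chen_fliess_term_summable[OF coeff[OF k(2,1)] Mpos _ inp(1)[OF that(2)] that(3) inp(2)[OF that(2)] \<rho>])
         (use C k in simp)
  qed
  have meas: "chen_fliess t0 c u \<in> borel_measurable (lebesgue_on {t0..b})" if "c \<in> V" "u \<in> B" for c u
    using measurable_chen_fliess[OF inp(1)[OF that(2)] summ[OF that]] by blast
  have bound: "norm (chen_fliess t0 c u t) \<le> C * k / (1 - M * \<rho>)"
    if "NV c \<le> ennreal k" "k \<ge> 0" "u \<in> B" "t \<in> {t0..b}" for c k u t
    by (rule norm_chen_fliess_le[OF coeff[OF that(1,2)] Mpos _ inp(1)[OF that(3)] that(4) inp(2)[OF that(3)] \<rho>])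
       (use C that in simp)
  have diff_input: "norm (chen_fliess t0 c v t - chen_fliess t0 c u t)
      \<le> C * k * (1 / (1 - M * (\<rho> + \<delta>)) - 1 / (1 - M * \<rho>))"
    if "NV c \<le> ennreal k" "k \<ge> 0" "u \<in> B" "v \<in> B" "t \<in> {t0..b}" "input_dist u v t0 b \<le> \<delta>" "M * (\<rho> + \<delta>) < 1"
    for c k u v t \<delta>
    by (rule norm_chen_fliess_diff_input_le[OF coeff[OF that(1,2)] Mpos _ inp(1)[OF that(3)] inp(1)[OF that(4)] that(5)
          inp(2)[OF that(3)] inp(2)[OF that(4)] \<rho> that(6,7)])
       (use C that in simp)
  \<comment> \<open>The difference of two series is itself a series, to which the preceding bound applies.\<close>
  have diff_series: "norm (chen_fliess t0 d u t - chen_fliess t0 c u t) \<le> C * k / (1 - M * \<rho>)"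
    if "c \<in> V" "d \<in> V" "NV (d - c) \<le> ennreal k" "k \<ge> 0" "u \<in> B" "t \<in> {t0..b}" for c d k u t
  proof -
    have "d - c \<in> V" using V_of that(3) by blast
    then have "chen_fliess t0 (c + (d - c)) u t = chen_fliess t0 c u t + chen_fliess t0 (d - c) u t"
      using that by (intro chen_fliess_add summ)
    moreover have "c + (d - c) = d" by (simp add: fun_eq_iff)
    ultimately have "chen_fliess t0 d u t - chen_fliess t0 c u t = chen_fliess t0 (d - c) u t" by simp
    then show ?thesis using bound[OF that(3-6)] by simp
  qed
  have NW_le: "NW f \<le> ennreal (K * \<Lambda>)"
    if "f \<in> borel_measurable (lebesgue_on {t0..b})" "\<And>t. t \<in> {t0..b} \<Longrightarrow> norm (f t) \<le> K" for f K
    using Lp_norm_le_bound[OF assms(3) b(1) that] by (simp add: NW_def \<Lambda>_def b)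
  have meas_diff: "chen_fliess t0 c u - chen_fliess t0 d v \<in> borel_measurable (lebesgue_on {t0..b})"
    if "c \<in> V" "u \<in> B" "d \<in> V" "v \<in> B" for c u d v
    using meas[OF that(1,2)] meas[OF that(3,4)] by (simp add: fun_diff_def)
  \<comment> \<open>Linearity holds on the interval only, where the series converge; the seminorm sees no more.\<close>
  have NW_zero: "NW f = 0" if "\<And>t. t \<in> {t0..b} \<Longrightarrow> f t = 0" for f
  proof -
    have "f \<in> borel_measurable (lebesgue_on {t0..b})"
      by (subst measurable_cong[where g = "\<lambda>_. 0"]) (use that in auto)
    from NW_le[OF this, of 0] that show ?thesis by simp
  qed
  have NW_F: "NW (chen_fliess t0 c u) \<le> ennreal (C * k / (1 - M * \<rho>) * \<Lambda>)"
    if "c \<in> V" "NV c \<le> ennreal k" "k \<ge> 0" "u \<in> B" for c k u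
    using that by (intro NW_le meas bound)
  have F_in_W: "chen_fliess t0 c u \<in> W" if "c \<in> V" "u \<in> B" for c u
  proof -
    obtain k where "k \<ge> 0" "NV c \<le> ennreal k" using V_obtain[OF \<open>c \<in> V\<close>] by blast
    then show ?thesis using NW_F[of c k u] that meas
      by (auto simp: W_def Lp_space_def NW_def intro: le_less_trans)
  qed
  \<comment> \<open>Equicontinuity in the input, for all series in a ball of radius \<open>k\<close>: first for the \<open>L\<^sub>1\<close>-distance
      of the inputs, then for the \<open>L\<^sub>p\<close>-norm.\<close>
  have uniform_u: "\<exists>\<delta>>0. \<forall>c\<in>V. NV c \<le> ennreal k \<longrightarrow> (\<forall>u\<in>B. \<forall>v\<in>B. input_dist u v t0 b \<le> \<delta> \<longrightarrow>
      (\<forall>t\<in>{t0..b}. norm (chen_fliess t0 c v t - chen_fliess t0 c u t) \<le> \<epsilon>))"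
    if "\<epsilon> > 0" "k \<ge> 0" for \<epsilon> k
  proof -
    obtain \<delta> where \<delta>: "\<delta> > 0" "M * (\<rho> + \<delta>) < 1" "C * k * (1 / (1 - M * (\<rho> + \<delta>)) - 1 / (1 - M * \<rho>)) \<le> \<epsilon>"
      using small_geometric_increment[OF \<rho> \<open>\<epsilon> > 0\<close>] by metis
    show ?thesis
      using \<delta> diff_input that(2) by (intro exI[of _ \<delta>]) (blast intro: order_trans)
  qed
  have uniform_u_norm: "\<exists>s>0. \<forall>c\<in>V. NV c \<le> ennreal k \<longrightarrow> (\<forall>u\<in>B. \<forall>v\<in>B. NB (v - u) < s \<longrightarrow>
      NW (chen_fliess t0 c v - chen_fliess t0 c u) \<le> ennreal \<epsilon>)"
    if "\<epsilon> > 0" "k \<ge> 0" for \<epsilon> k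
  proof -
    have "\<epsilon> / \<Lambda> > 0" using that \<Lambda> by simp
    from uniform_u[OF this that(2)] obtain \<delta> where \<delta>: "\<delta> > 0"
      and le: "\<And>c u v t. \<lbrakk>c \<in> V; NV c \<le> ennreal k; u \<in> B; v \<in> B; input_dist u v t0 b \<le> \<delta>; t \<in> {t0..b}\<rbrakk>
        \<Longrightarrow> norm (chen_fliess t0 c v t - chen_fliess t0 c u t) \<le> \<epsilon> / \<Lambda>" by metis
    obtain s where s: "s > 0" "\<forall>u\<in>B. \<forall>v\<in>B. NB (v - u) < ennreal s \<longrightarrow> input_dist u v t0 b \<le> \<delta>"
      using dist_small[OF \<delta>] by auto
    have "NW (chen_fliess t0 c v - chen_fliess t0 c u) \<le> ennreal (\<epsilon> / \<Lambda> * \<Lambda>)"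
      if "c \<in> V" "NV c \<le> ennreal k" "u \<in> B" "v \<in> B" "NB (v - u) < ennreal s" for c u v
      using that s le by (intro NW_le meas_diff) auto
    then show ?thesis using s \<Lambda> by (intro exI[of _ "ennreal s"]) auto
  qed

  have Phi_BC: "(\<lambda>u. chen_fliess t0 c u) \<in> BC B NB W NW" if c: "c \<in> V" for c
  proof -
    obtain k where k: "k \<ge> 0" "NV c \<le> ennreal k" using V_obtain[OF c] by blast
    have "continuous_map (seminorm_topology B NB) (seminorm_topology W NW) (\<lambda>u. chen_fliess t0 c u)"
    proof (rule continuous_map_seminorm_topologyI)
      show "(\<lambda>u. chen_fliess t0 c u) \<in> B \<rightarrow> W" using F_in_W[OF c] by auto
      show "\<exists>\<delta>>0. \<forall>v\<in>B. NB (v - u) < \<delta> \<longrightarrow> NW (chen_fliess t0 c v - chen_fliess t0 c u) \<le> ennreal \<epsilon>"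
        if "u \<in> B" "\<epsilon> > 0" for u \<epsilon>
        using uniform_u_norm[OF that(2) k(1)] c k(2) that(1) by blast
    qed
    moreover have "sup_norm B NW (\<lambda>u. chen_fliess t0 c u) \<le> ennreal (C * k / (1 - M * \<rho>) * \<Lambda>)"
      unfolding sup_norm_def using NW_F[OF c k(2,1)] by (intro SUP_least)
    ultimately show ?thesis by (auto simp: BC_def intro: le_less_trans)
  qed
  have Phi: "continuous_map (seminorm_topology V NV) (seminorm_topology (BC B NB W NW) (sup_norm B NW))
      (\<lambda>c u. chen_fliess t0 c u)"
  proof (rule continuous_map_seminorm_topologyI)
    show "(\<lambda>c u. chen_fliess t0 c u) \<in> V \<rightarrow> BC B NB W NW" using Phi_BC by auto
    fix c and \<epsilon> :: real assume c: "c \<in> V" and \<epsilon>: "\<epsilon> > 0"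
    \<comment> \<open>The operator norm of \<open>c \<mapsto> F\<^sub>c\<close> is at most \<open>C \<Lambda> / (1 - M \<rho>)\<close>.\<close>
    define \<delta> where "\<delta> = \<epsilon> * (1 - M * \<rho>) / (C * \<Lambda>)"
    have \<delta>: "\<delta> > 0" using \<epsilon> \<rho> C \<Lambda> by (simp add: \<delta>_def)
    have "sup_norm B NW ((\<lambda>u. chen_fliess t0 d u) - (\<lambda>u. chen_fliess t0 c u)) \<le> ennreal \<epsilon>"
      if d: "d \<in> V" "NV (d - c) < ennreal \<delta>" for d
    proof -
      have "NW (chen_fliess t0 d u - chen_fliess t0 c u) \<le> ennreal (C * \<delta> / (1 - M * \<rho>) * \<Lambda>)" if "u \<in> B" for u
        using that d c \<delta> diff_series[OF c d(1) less_imp_le[OF d(2)]] by (intro NW_le meas_diff) auto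
      moreover have "C * \<delta> / (1 - M * \<rho>) * \<Lambda> = \<epsilon>" using \<rho> C \<Lambda> by (simp add: \<delta>_def)
      ultimately show ?thesis unfolding sup_norm_def by (intro SUP_least) simp
    qed
    then show "\<exists>\<delta>>0. \<forall>d\<in>V. NV (d - c) < \<delta> \<longrightarrow>
        sup_norm B NW ((\<lambda>u. chen_fliess t0 d u) - (\<lambda>u. chen_fliess t0 c u)) \<le> ennreal \<epsilon>"
      using \<delta> by (intro exI[of _ "ennreal \<delta>"]) auto
  qed
  have Psi_lin: "(\<lambda>c. chen_fliess t0 c u) \<in> bounded_lin V NV W NW" if u: "u \<in> B" for u
  proof -
    have "op_norm V NV NW (\<lambda>c. chen_fliess t0 c u) \<le> ennreal (C * 1 / (1 - M * \<rho>) * \<Lambda>)"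
      unfolding op_norm_def using NW_F[of _ 1 u] u by (intro SUP_least) auto
    then have "op_norm V NV NW (\<lambda>c. chen_fliess t0 c u) < \<infinity>" by (auto intro: le_less_trans)
    moreover have "NW (chen_fliess t0 (c + d) u - (chen_fliess t0 c u + chen_fliess t0 d u)) = 0"
      if "c \<in> V" "d \<in> V" for c d
      using that u by (intro NW_zero) (simp add: chen_fliess_add summ)
    moreover have "NW (chen_fliess t0 (\<lambda>\<eta>. r *\<^sub>R c \<eta>) u - (\<lambda>t. r *\<^sub>R chen_fliess t0 c u t)) = 0" for r c
      by (intro NW_zero) (simp add: chen_fliess_scaleR)
    ultimately show ?thesis using F_in_W u by (auto simp: bounded_lin_def)
  qed
  have Psi: "continuous_map (seminorm_topology B NB) (seminorm_topology (bounded_lin V NV W NW) (op_norm V NV NW))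
      (\<lambda>u c. chen_fliess t0 c u)"
  proof (rule continuous_map_seminorm_topologyI)
    show "(\<lambda>u c. chen_fliess t0 c u) \<in> B \<rightarrow> bounded_lin V NV W NW" using Psi_lin by auto
    fix u and \<epsilon> :: real assume u: "u \<in> B" and \<epsilon>: "\<epsilon> > 0"
    obtain s where s: "s > 0" and le: "\<And>c v. \<lbrakk>c \<in> V; NV c \<le> 1; v \<in> B; NB (v - u) < s\<rbrakk> \<Longrightarrow>
        NW (chen_fliess t0 c v - chen_fliess t0 c u) \<le> ennreal \<epsilon>"
      using uniform_u_norm[OF \<epsilon>, of 1] u by auto
    show "\<exists>\<delta>>0. \<forall>v\<in>B. NB (v - u) < \<delta> \<longrightarrow>
        op_norm V NV NW ((\<lambda>c. chen_fliess t0 c v) - (\<lambda>c. chen_fliess t0 c u)) \<le> ennreal \<epsilon>"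
      unfolding op_norm_def using s le by (intro exI[of _ s]) (auto intro!: SUP_least)
  qed
  have joint: "continuous_map (prod_topology (seminorm_topology V NV) (seminorm_topology B NB))
      (seminorm_topology W NW) (\<lambda>(c, u). chen_fliess t0 c u)"
    unfolding continuous_map_def topspace_prod_topology topspace_seminorm_topology
  proof (intro conjI allI impI)
    show "(\<lambda>(c, u). chen_fliess t0 c u) \<in> V \<times> B \<rightarrow> W" using F_in_W by auto
    fix U assume U: "openin (seminorm_topology W NW) U"
    show "openin (prod_topology (seminorm_topology V NV) (seminorm_topology B NB))
        {x \<in> V \<times> B. (case x of (c, u) \<Rightarrow> chen_fliess t0 c u) \<in> U}"
      unfolding openin_prod_topology_alt
    proof (intro allI impI)
      fix c u assume "(c, u) \<in> {x \<in> V \<times> B. (case x of (c, u) \<Rightarrow> chen_fliess t0 c u) \<in> U}"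
      then have cu: "c \<in> V" "u \<in> B" "chen_fliess t0 c u \<in> U" by auto
      obtain e where e: "e > 0" "\<forall>f\<in>W. NW (f - chen_fliess t0 c u) < e \<longrightarrow> f \<in> U"
        using U cu(3) unfolding openin_seminorm_topology by blast
      obtain \<epsilon> where \<epsilon>: "\<epsilon> > 0" "ennreal \<epsilon> < e" using ennreal_less_obtain_real[OF e(1)] by metis
      obtain k where k: "k \<ge> 0" "NV c \<le> ennreal k" using V_obtain[OF cu(1)] by blast
      have "\<epsilon> / (2 * \<Lambda>) > 0" using \<epsilon> \<Lambda> by simp
      from uniform_u[OF this k(1)] obtain \<delta> where \<delta>: "\<delta> > 0"
        and le_u: "\<And>v t. \<lbrakk>v \<in> B; input_dist u v t0 b \<le> \<delta>; t \<in> {t0..b}\<rbrakk>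
          \<Longrightarrow> norm (chen_fliess t0 c v t - chen_fliess t0 c u t) \<le> \<epsilon> / (2 * \<Lambda>)" using cu k(2) by metis
      define \<delta>' where "\<delta>' = \<epsilon> / (2 * \<Lambda>) * (1 - M * \<rho>) / C"
      have \<delta>': "\<delta>' > 0" using \<epsilon> \<rho> C \<Lambda> by (simp add: \<delta>'_def)
      have le_c: "norm (chen_fliess t0 d v t - chen_fliess t0 c v t) \<le> \<epsilon> / (2 * \<Lambda>)"
        if "d \<in> V" "NV (d - c) < ennreal \<delta>'" "v \<in> B" "t \<in> {t0..b}" for d v t
        using diff_series[OF cu(1) that(1) less_imp_le[OF that(2)] less_imp_le[OF \<delta>'] that(3,4)] C \<rho>
        by (simp add: \<delta>'_def)
      \<comment> \<open>Neighbourhoods of \<open>c\<close> and \<open>u\<close>; the second one is a ball for the \<open>L\<^sub>1\<close>-distance, whose triangle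
          inequality is elementary.\<close>
      define P where "P = {d \<in> V. NV (d - c) < ennreal \<delta>'}"
      define Q where "Q = {v \<in> B. input_dist u v t0 b < \<delta>}"
      have "openin (seminorm_topology V NV) P"
        unfolding openin_seminorm_topology
      proof (intro conjI ballI)
        fix d assume "d \<in> P"
        then have d: "d \<in> V" "NV (d - c) < ennreal \<delta>'" by (auto simp: P_def)
        have "d' \<in> P" if "d' \<in> V" "NV (d' - d) < ennreal \<delta>' - NV (d - c)" for d'
        proof -
          have "(d' - d) + (d - c) = d' - c" by (simp add: fun_eq_iff)
          then have "NV (d' - c) \<le> NV (d' - d) + NV (d - c)"
            using linf_norm_triangle[OF Mpos, of "d' - d" "d - c"] by (simp add: NV_def)
          also have "\<dots> < ennreal \<delta>'" using that(2) d(2) by (simp add: less_diff_eq_ennreal)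
          finally show ?thesis using that(1) by (simp add: P_def)
        qed
        then show "\<exists>e>0. \<forall>d'\<in>V. NV (d' - d) < e \<longrightarrow> d' \<in> P"
          using d by (intro exI[of _ "ennreal \<delta>' - NV (d - c)"]) (auto simp: diff_gr0_ennreal)
      qed (auto simp: P_def)
      moreover have "openin (seminorm_topology B NB) Q"
        unfolding openin_seminorm_topology
      proof (intro conjI ballI)
        fix v assume "v \<in> Q"
        then have v: "v \<in> B" "input_dist u v t0 b < \<delta>" by (auto simp: Q_def)
        then have "(\<delta> - input_dist u v t0 b) / 2 > 0" by simp
        from dist_small[OF this] obtain s where s: "s > 0" "\<forall>y\<in>B. \<forall>w\<in>B. NB (w - y) < ennreal s \<longrightarrow>
            input_dist y w t0 b \<le> (\<delta> - input_dist u v t0 b) / 2"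
          by blast
        have "w \<in> Q" if "w \<in> B" "NB (w - v) < ennreal s" for w
        proof -
          have "input_dist u w t0 b \<le> input_dist u v t0 b + input_dist v w t0 b"
            using input_dist_triangle inp(1) cu(2) v(1) that(1) by blast
          moreover have "input_dist v w t0 b \<le> (\<delta> - input_dist u v t0 b) / 2"
            using s(2) v(1) that by blast
          ultimately show ?thesis using v(2) that(1) by (simp add: Q_def field_simps)
        qed
        then show "\<exists>e>0. \<forall>w\<in>B. NB (w - v) < e \<longrightarrow> w \<in> Q"
          using s(1) by (intro exI[of _ "ennreal s"]) auto
      qed (auto simp: Q_def)
      moreover have "c \<in> P"
      proof -
        have "c - c = (\<lambda>_. 0)" by (simp add: fun_eq_iff)
        then have "NV (c - c) \<le> ennreal 0"
          using linf_norm_le_iff[OF Mpos, of 0 "c - c"] by (simp add: NV_def infnorm_0)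
        then show ?thesis using cu \<delta>' by (simp add: P_def)
      qed
      moreover have "u \<in> Q" using cu \<delta> by (simp add: Q_def input_dist_def)
      moreover have "chen_fliess t0 d v \<in> U" if "d \<in> P" "v \<in> Q" for d v
      proof -
        have dv: "d \<in> V" "NV (d - c) < ennreal \<delta>'" "v \<in> B" "input_dist u v t0 b \<le> \<delta>"
          using that by (auto simp: P_def Q_def)
        have "norm ((chen_fliess t0 d v - chen_fliess t0 c u) t) \<le> \<epsilon> / \<Lambda>" if "t \<in> {t0..b}" for t
        proof -
          have "(chen_fliess t0 d v - chen_fliess t0 c u) t = (chen_fliess t0 d v t - chen_fliess t0 c v t)
              + (chen_fliess t0 c v t - chen_fliess t0 c u t)" by simp
          also have "norm \<dots> \<le> \<epsilon> / (2 * \<Lambda>) + \<epsilon> / (2 * \<Lambda>)"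
            using le_c[OF dv(1-3) that] le_u[OF dv(3,4) that] by (intro norm_triangle_le add_mono)
          finally show ?thesis by (simp add: field_simps)
        qed
        then have "NW (chen_fliess t0 d v - chen_fliess t0 c u) \<le> ennreal (\<epsilon> / \<Lambda> * \<Lambda>)"
          using dv cu by (intro NW_le meas_diff) auto
        then have "NW (chen_fliess t0 d v - chen_fliess t0 c u) < e" using \<epsilon>(2) \<Lambda> by simp
        then show ?thesis using e(2) F_in_W dv by blast
      qed
      ultimately show "\<exists>P Q. openin (seminorm_topology V NV) P \<and> openin (seminorm_topology B NB) Q \<and>
          c \<in> P \<and> u \<in> Q \<and> P \<times> Q \<subseteq> {x \<in> V \<times> B. (case x of (c, u) \<Rightarrow> chen_fliess t0 c u) \<in> U}"
        by (intro exI[of _ P] exI[of _ Q]) (auto simp: P_def Q_def)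
    qed
  qed
  show ?thesis
    using summ Phi Psi joint
    unfolding Let_def V_def NV_def B_def NB_def W_def NW_def b_def by blast
qed

end
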